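(* For every $\varepsilon>0$ there exist constants $C_\varepsilon>0$ and $X_0(\varepsilon)$ such that the following holds. Let $q$ be a positive integer, let $I$ be an interval of length $A<q$, and let $\mathcal{A}=I\cap\mathbb{Z}_q^*$. Then for all $X\ge \max\{q,X_0(\varepsilon)\}$ with $q^3<AX^2/8$, $$\Bigl|\sum_{a\in\mathcal{A}}\mathrm{R}(X;a,q)\Bigr|\le C_\varepsilon X^{\varepsilon}\bigl(E(A,X,q)+A^{2/3}X^{1/3}\bigr),$$ where $$E(A,X,q)=\min\bigl\{q^{1/2}X^{1/4}+X^{1/2},\ X^{1/2}(A^{1/4}+Aq^{-1/2}),\ X^{1/2}(1+Aq^{-1/4})\bigr\}.$$
   Context: An interval $I$ of length $A$ is a set of $A$ consecutive integers, $I=\{B+1,\dots,B+A\}$, and $I\cap\mathbb{Z}_q^*$ denotes the set of its elements coprime to $q$ (viewed modulo $q$). Let $\tau(n)$ be the number of positive divisors of $n$, $\varphi$ Euler's function, $\mu$ the Möbius function, $\gamma$ Euler's constant. For $\gcd(a,q)=1$ define $$S(X;a,q)=\sum_{\substack{n\le X\\ n\equiv a \,(\mathrm{mod}\, q)}}\tau(n),\qquad \mathrm{M}(X;a,q)=\frac{\varphi(q)}{q^2}X(\log X+2\gamma-1)-\frac{2}{q}X\sum_{d\mid q}\frac{\mu(d)\log d}{d},$$ and $\mathrm{R}(X;a,q)=S(X;a,q)-\mathrm{M}(X;a,q)$. The factor $X^{o(1)}$ in the paper means: for every $\varepsilon>0$ the bound holds with $C_\varepsilon X^\varepsilon$ for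 all sufficiently large $X$; this has been written out in the claim. *)

theory Defs
  imports
    "HOL-Analysis.Analysis"
    "HOL-Computational_Algebra.Squarefree"
    "HOL-Number_Theory.Totient"
    "HOL-Number_Theory.Cong"
begin

definition tau :: "nat \<Rightarrow> nat" where
  "tau n = card {d. d dvd n}"

definition moebius_mu :: "nat \<Rightarrow> int" where
  "moebius_mu n = (if squarefree n then (- 1) ^ card (prime_factors n) else 0)"

text \<open>Residues are represented by arbitrary integers \<open>a\<close>; summation is over
  positive \<open>n\<close>, and \<open>X\<close> is a real parameter.\<close>

definition S :: "real \<Rightarrow> int \<Rightarrow> nat \<Rightarrow> real" where
  "S X a q = (\<Sum>n | 1 \<le> n \<and> real n \<le> X \<and> [int n = a] (mod int q). real (tau n))"

text \<open>The main term is the same for all \<open>a\<close> coprime to \<open>q\<close>; the argument \<open>a\<close> is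
  kept only to match the usual notation.\<close>

definition M :: "real \<Rightarrow> int \<Rightarrow> nat \<Rightarrow> real" where
  "M X a q =
     real (totient q) / (real q)\<^sup>2 * X * (ln X + 2 * euler_mascheroni - 1)
     - 2 / real q * X * (\<Sum>d | d dvd q. of_int (moebius_mu d) * ln (real d) / real d)"

definition R :: "real \<Rightarrow> int \<Rightarrow> nat \<Rightarrow> real" where
  "R X a q = S X a q - M X a q"

definition interval :: "int \<Rightarrow> nat \<Rightarrow> int set" where
  "interval B A = {B + 1..B + int A}"

text \<open>For an interval of length less than \<open>q\<close>, distinct elements are distinct modulo \<open>q\<close>,
  so its reduced residues modulo \<open>q\<close> can be identified with its integer elements
  coprime to \<open>q\<close>.\<close>

definition reduced_part :: "int set \<Rightarrow> nat \<Rightarrow> int set" where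
  "reduced_part I q = {a \<in> I. coprime a (int q)}"

definition E :: "nat \<Rightarrow> real \<Rightarrow> nat \<Rightarrow> real" where
  "E A X q = Min
     {real q powr (1/2) * X powr (1/4) + X powr (1/2),
      X powr (1/2) * (real A powr (1/4) + real A * real q powr (- 1/2)),
      X powr (1/2) * (1 + real A * real q powr (- 1/4))}"

end

theory Submission
  imports Defs
begin

text \<open>
  The error is in fact \<open>O(X powr \<epsilon> * (sqrt X + A))\<close>, by elementary means. Since \<open>1 \<le> A < q \<le> X\<close>, we have
  \<open>sqrt X \<le> E A X q\<close> and \<open>A \<le> A powr (2/3) * X powr (1/3)\<close>, so this suffices.

  By the hyperbola method one has to count, on average over \<open>m \<le> sqrt X\<close> coprime to \<open>q\<close>, the \<open>n \<le> X / m\<close>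
  with \<open>m * n\<close> congruent modulo \<open>q\<close> to an element of the interval; Moebius inversion over \<open>d\<close> dividing \<open>q\<close>
  removes the coprimality condition and replaces \<open>q\<close> by \<open>q / d\<close>. Expanding the congruence in additive
  characters and summing two geometric progressions, the total error is at most the sum over \<open>m\<close> and over
  centred residues \<open>h \<noteq> 0\<close> of \<open>min A (q / \<bar>h\<bar>) / \<bar>u\<bar>\<close>, where \<open>u\<close> is the centred residue of \<open>h * m\<close>.
  Writing \<open>h * m = k * q + u\<close> and bounding the number of \<open>(h, m)\<close> with a given product by the divisor
  function, the terms with \<open>k = 0\<close> contribute \<open>A\<close> and those with \<open>k \<noteq> 0\<close> contribute \<open>sqrt X\<close>, up to factors
  \<open>X powr \<epsilon>\<close>.
\<close>

section \<open>The divisor and Moebius functions\<close>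

text \<open>Each divisor of \<open>a * b\<close> is a divisor of \<open>a\<close> times a divisor of
  \<open>b\<close>, so multiplication maps the pairs of divisors onto the divisors of the
  product.\<close>

lemma tau_mult_le: "a > 0 \<Longrightarrow> b > 0 \<Longrightarrow> tau (a * b) \<le> tau a * tau b"
proof -
  assume ab: "a > 0" "b > 0"
  have fin: "finite {d. d dvd a}" "finite {d. d dvd b}" using ab by auto
  have "{d. d dvd a * b} \<subseteq> (\<lambda>(x, y). x * y) ` ({d. d dvd a} \<times> {d. d dvd b})"
  proof
    fix d assume "d \<in> {d. d dvd a * b}"
    then obtain x y where "d = x * y" "x dvd a" "y dvd b"
      using division_decomp[of d a b] by auto
    then show "d \<in> (\<lambda>(x, y). x * y) ` ({d. d dvd a} \<times> {d. d dvd b})" by force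
  qed
  then have "tau (a * b) \<le> card ((\<lambda>(x, y). x * y) ` ({d. d dvd a} \<times> {d. d dvd b}))"
    unfolding tau_def using fin by (intro card_mono) auto
  also have "\<dots> \<le> card ({d. d dvd a} \<times> {d. d dvd b})"
    using fin by (intro card_image_le) auto
  also have "\<dots> = tau a * tau b" by (simp add: tau_def card_cartesian_product)
  finally show ?thesis .
qed

lemma tau_prime_power: "prime p \<Longrightarrow> tau (p ^ e) = e + 1"
proof -
  assume p: "prime p"
  have "{d. d dvd p ^ e} = (\<lambda>i. p ^ i) ` {..e}"
    using divides_primepow_nat[OF p, of _ e] by auto
  moreover have "inj_on (\<lambda>i. p ^ i) {..e}"
    using p by (intro inj_onI) (auto dest: prime_gt_1_nat)
  ultimately show ?thesis by (simp add: tau_def card_image)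
qed

text \<open>Each prime power \<open>p ^ e\<close> contributes \<open>e + 1 \<le> 2 ^ e\<close>; this is at most \<open>p powr (e * \<epsilon>)\<close>
  unless \<open>p powr \<epsilon> < 2\<close>, so that only boundedly many primes cost a factor \<open>K\<close>.\<close>

lemma tau_le_powr_aux:
  fixes \<epsilon> K :: real
  assumes eps: "\<epsilon> > 0" and K: "K \<ge> 1" "\<And>e::nat. real e + 1 \<le> K * 2 powr (\<epsilon> * e)"
    and P: "2 \<le> real P powr \<epsilon>"
  shows "n > 0 \<Longrightarrow> real (tau n) \<le> K ^ card {p \<in> prime_factors n. p < P} * real n powr \<epsilon>"
proof (induction n rule: less_induct)
  case (less n)
  show ?case
  proof (cases "n = 1")
    case True
    then show ?thesis by (simp add: tau_def)
  next
    case False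
    then obtain p where p: "prime p" "p dvd n" using prime_factor_nat by blast
    define e where "e = multiplicity p n"
    obtain m where m: "n = p ^ e * m" "\<not> p dvd m"
      using multiplicity_decompose'[of n p] less.prems p unfolding e_def
      by (metis not_prime_unit not_gr_zero)
    have m0: "m > 0" using m less.prems by auto
    have p2: "p \<ge> 2" using p prime_ge_2_nat by blast
    have e0: "e > 0" unfolding e_def using p less.prems prime_multiplicity_gt_zero_iff by auto
    have "p ^ e \<ge> 2 ^ 1"
      using p2 e0 by (metis One_nat_def Suc_leI le_trans power_increasing power_mono one_le_numeral zero_le)
    then have mn: "m < n" using m m0 by auto
    have IH: "real (tau m) \<le> K ^ card {p \<in> prime_factors m. p < P} * real m powr \<epsilon>"
      using less.IH[OF mn m0] .
    have pf: "prime_factors n = insert p (prime_factors m)"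
      using m m0 e0 p p2 by (simp add: prime_factors_product prime_factors_power prime_prime_factors)
    have pnot: "p \<notin> prime_factors m" using m by auto
    have "real (tau n) \<le> real (tau (p ^ e)) * real (tau m)"
      using tau_mult_le[of "p ^ e" m] m m0 p2 by (metis of_nat_le_iff of_nat_mult pos2 zero_less_power less_le_trans)
    also have "\<dots> = (real e + 1) * real (tau m)" by (simp add: tau_prime_power[OF p(1)])
    finally have t: "real (tau n) \<le> (real e + 1) * real (tau m)" .
    have npow: "real n powr \<epsilon> = (real p powr \<epsilon>) ^ e * real m powr \<epsilon>"
      using m by (simp add: powr_mult powr_power mult.commute powr_powr flip: powr_realpow)
        (use p2 in \<open>simp add: powr_powr mult.commute flip: powr_realpow\<close>)
    show ?thesis
    proof (cases "p < P")
      case True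
      have "{p \<in> prime_factors n. p < P} = insert p {p \<in> prime_factors m. p < P}"
        using pf True by auto
      then have c: "card {p \<in> prime_factors n. p < P} = Suc (card {p \<in> prime_factors m. p < P})"
        using pnot by simp
      have "real e + 1 \<le> K * (2 powr \<epsilon>) ^ e"
        using K(2)[of e] by (simp add: powr_power mult.commute)
      also have "\<dots> \<le> K * (real p powr \<epsilon>) ^ e"
        using p2 K eps by (intro mult_left_mono power_mono powr_mono2) auto
      finally have "(real e + 1) * real (tau m)
        \<le> (K * (real p powr \<epsilon>) ^ e) * (K ^ card {p \<in> prime_factors m. p < P} * real m powr \<epsilon>)"
        using IH K by (intro mult_mono) auto
      then show ?thesis using t unfolding c npow by (simp add: mult_ac)
    next
      case False
      have "{p \<in> prime_factors n. p < P} = {p \<in> prime_factors m. p < P}"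
        using pf False by auto
      then have c: "card {p \<in> prime_factors n. p < P} = card {p \<in> prime_factors m. p < P}" by simp
      have "Suc e \<le> 2 ^ e" by (simp add: Suc_leI)
      then have "real (Suc e) \<le> real (2 ^ e)" by (simp only: of_nat_le_iff)
      then have "real e + 1 \<le> 2 ^ e" by simp
      also have "\<dots> \<le> (real P powr \<epsilon>) ^ e" using P by (intro power_mono) auto
      also have "\<dots> \<le> (real p powr \<epsilon>) ^ e"
        using False eps by (intro power_mono powr_mono2) auto
      finally have "(real e + 1) * real (tau m)
        \<le> ((real p powr \<epsilon>) ^ e) * (K ^ card {p \<in> prime_factors m. p < P} * real m powr \<epsilon>)"
        using IH K by (intro mult_mono) auto
      then show ?thesis using t unfolding c npow by (simp add: mult_ac)
    qed
  qed
qed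

text \<open>Fewer than \<open>P + 1\<close> primes lie below the threshold \<open>P\<close>, and
  each costs a factor \<open>K\<close>, so \<open>K ^ P\<close> serves as the constant.\<close>

lemma tau_le_powr:
  fixes \<epsilon> :: real
  assumes eps: "\<epsilon> > 0"
  shows "\<exists>C\<ge>1. \<forall>n>0. real (tau n) \<le> C * real n powr \<epsilon>"
proof -
  define K where "K = 1 + 1 / (\<epsilon> * ln 2)"
  define P where "P = nat \<lceil>2 powr (1 / \<epsilon>)\<rceil>"
  have l2: "ln (2::real) > 0" by simp
  have K1: "K \<ge> 1" using eps unfolding K_def by simp
  have K2: "real e + 1 \<le> K * 2 powr (\<epsilon> * e)" for e :: nat
  proof -
    \<comment> \<open>The factor \<open>1 + 1 / (\<epsilon> * ln 2)\<close> makes the coefficient of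
      \<open>e\<close> on the right at least 1; then \<open>1 + x \<le> exp x\<close> is
      applied.\<close>
    have "real e + 1 \<le> K * (1 + \<epsilon> * e * ln 2)"
      using eps l2 unfolding K_def by (simp add: field_simps)
    also have "\<dots> \<le> K * exp (\<epsilon> * e * ln 2)"
      using K1 by (intro mult_left_mono exp_ge_add_one_self) auto
    finally show ?thesis by (simp add: powr_def)
  qed
  have "2 = (2 powr (1 / \<epsilon>)) powr \<epsilon>" using eps by (simp add: powr_powr)
  also have "\<dots> \<le> real P powr \<epsilon>" using eps unfolding P_def
    by (intro powr_mono2) (auto simp: real_nat_ceiling_ge)
  finally have P: "2 \<le> real P powr \<epsilon>" .
  have "real (tau n) \<le> K ^ P * real n powr \<epsilon>" if "n > 0" for n
  proof -
    have "card {p \<in> prime_factors n. p < P} \<le> card {..<P}" by (intro card_mono) auto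
    then have "K ^ card {p \<in> prime_factors n. p < P} \<le> K ^ P"
      using K1 by (intro power_increasing) auto
    then have "K ^ card {p \<in> prime_factors n. p < P} * real n powr \<epsilon> \<le> K ^ P * real n powr \<epsilon>"
      by (intro mult_right_mono) auto
    then show ?thesis using tau_le_powr_aux[OF eps K1 K2 P that] by linarith
  qed
  moreover have "K ^ P \<ge> 1" using K1 by simp
  ultimately show ?thesis by blast
qed

section \<open>Moebius inversion over the divisors of the modulus\<close>

lemma moebius_mu_prime_mult:
  assumes "prime p" "\<not> p dvd d" "squarefree d"
  shows "moebius_mu (p * d) = - moebius_mu d"
proof -
  have d0: "d \<noteq> 0" using assms by (metis dvd_0_right)
  have cop: "coprime p d" using assms by (simp add: prime_imp_coprime)
  have sf: "squarefree (p * d)"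
    using assms cop by (intro squarefree_mult_coprime) (auto simp: squarefree_prime)
  have "prime_factors (p * d) = insert p (prime_factors d)"
    using assms d0 prime_gt_0_nat[of p] by (simp add: prime_factors_product prime_prime_factors)
  moreover have "p \<notin> prime_factors d" using assms by auto
  ultimately show ?thesis using assms sf by (simp add: moebius_mu_def)
qed

text \<open>For \<open>n > 1\<close> fix a prime \<open>p\<close> dividing \<open>n\<close>. The
  squarefree divisors pair off as \<open>d\<close> and \<open>p * d\<close> with \<open>d\<close>
  prime to \<open>p\<close>, and the two values in each pair cancel.\<close>

lemma sum_moebius_divisors:
  assumes "n > 0"
  shows "(\<Sum>d | d dvd n. moebius_mu d) = (if n = 1 then 1 else 0)"
proof (cases "n = 1")
  case True
  then show ?thesis by (simp add: moebius_mu_def)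
next
  case False
  then obtain p where p: "prime p" "p dvd n" using prime_factor_nat by blast
  define D where "D = {d. d dvd n \<and> squarefree d \<and> \<not> p dvd d}"
  have p0: "p > 0" using p prime_gt_0_nat by blast
  have fin: "finite {d. d dvd n}" using assms by simp
  have finD: "finite D" unfolding D_def by (rule finite_subset[OF _ fin]) auto
  have split: "{d. d dvd n \<and> squarefree d} = D \<union> (*) p ` D"
  proof (intro equalityI subsetI)
    fix d assume d: "d \<in> {d. d dvd n \<and> squarefree d}"
    show "d \<in> D \<union> (*) p ` D"
    proof (cases "p dvd d")
      case True
      then obtain k where k: "d = p * k" by blast
      have "\<not> p dvd k"
      proof
        assume "p dvd k"
        then have "p ^ 2 dvd d" using k by (auto simp: power2_eq_square)
        then have "is_unit p" using d squarefreeD by blast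
        then show False using p by auto
      qed
      moreover have "k dvd n" "squarefree k"
        using d k by (auto intro: dvd_mult_right dest: squarefree_multD)
      ultimately show ?thesis using k unfolding D_def by auto
    qed (use d in \<open>auto simp: D_def\<close>)
  next
    fix d assume "d \<in> D \<union> (*) p ` D"
    then show "d \<in> {d. d dvd n \<and> squarefree d}"
    proof
      assume "d \<in> (*) p ` D"
      then obtain k where k: "d = p * k" "k dvd n" "squarefree k" "\<not> p dvd k"
        by (auto simp: D_def)
      have "coprime p k" using p k by (simp add: prime_imp_coprime)
      then have "p * k dvd n" "squarefree (p * k)"
        using p k by (auto intro: divides_mult squarefree_mult_coprime simp: squarefree_prime)
      then show ?thesis using k by auto
    qed (auto simp: D_def)
  qed
  have "(\<Sum>d | d dvd n. moebius_mu d) = (\<Sum>d | d dvd n \<and> squarefree d. moebius_mu d)"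
    by (rule sum.mono_neutral_right[OF fin]) (auto simp: moebius_mu_def)
  also have "\<dots> = (\<Sum>d\<in>D. moebius_mu d) + (\<Sum>d\<in>(*) p ` D. moebius_mu d)"
    unfolding split using finD by (intro sum.union_disjoint) (auto simp: D_def)
  also have "(\<Sum>d\<in>(*) p ` D. moebius_mu d) = (\<Sum>d\<in>D. moebius_mu (p * d))"
    using p0 by (subst sum.reindex) (auto simp: inj_on_def)
  also have "\<dots> = (\<Sum>d\<in>D. - moebius_mu d)"
    using p by (intro sum.cong) (auto simp: D_def moebius_mu_prime_mult)
  finally show ?thesis using False by (simp add: sum_negf)
qed

lemma abs_moebius_mu_le: "\<bar>moebius_mu d\<bar> \<le> 1"
  by (simp add: moebius_mu_def power_abs)

text \<open>The divisors of \<open>q\<close> that also divide \<open>a\<close> are exactly the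
  divisors of their gcd, so the Moebius sum over the divisors of that gcd decides.\<close>

lemma coprime_indicator_moebius:
  assumes "q > 0"
  shows "(\<Sum>d | d dvd q. if int d dvd a then of_int (moebius_mu d) else 0)
    = (if coprime a (int q) then 1 else (0::real))"
proof -
  define g where "g = nat (gcd a (int q))"
  have g0: "g > 0" using assms by (simp add: g_def)
  have dv: "d dvd g \<longleftrightarrow> d dvd q \<and> int d dvd a" for d
  proof -
    have "d dvd g \<longleftrightarrow> int d dvd gcd a (int q)"
      unfolding g_def by (metis gcd_ge_0_int int_dvd_int_iff int_nat_eq)
    then show ?thesis by auto
  qed
  have "(\<Sum>d | d dvd q. if int d dvd a then of_int (moebius_mu d) else 0) =
    (\<Sum>d | d dvd g. real_of_int (moebius_mu d))"
    using assms dv by (intro sum.mono_neutral_cong_right) auto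
  also have "\<dots> = of_int (if g = 1 then 1 else 0)"
    using sum_moebius_divisors[OF g0] by (simp flip: of_int_sum)
  also have "g = 1 \<longleftrightarrow> coprime a (int q)"
    unfolding g_def coprime_iff_gcd_eq_1 by (simp add: nat_eq_iff)
  finally show ?thesis by simp
qed

lemma sum_coprime_moebius:
  fixes f :: "int \<Rightarrow> real"
  assumes "q > 0" "finite A"
  shows "(\<Sum>a | a \<in> A \<and> coprime a (int q). f a)
    = (\<Sum>d | d dvd q. of_int (moebius_mu d) * (\<Sum>a | a \<in> A \<and> int d dvd a. f a))"
proof -
  have "(\<Sum>a | a \<in> A \<and> coprime a (int q). f a)
      = (\<Sum>a\<in>A. (\<Sum>d | d dvd q. if int d dvd a then of_int (moebius_mu d) else 0) * f a)"
    using assms unfolding coprime_indicator_moebius[OF assms(1)]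
    by (intro sum.mono_neutral_cong_left) auto
  also have "\<dots> = (\<Sum>d | d dvd q. \<Sum>a\<in>A. (if int d dvd a then of_int (moebius_mu d) else 0) * f a)"
    by (simp add: sum_distrib_right sum.swap[of _ A])
  also have "\<dots> = (\<Sum>d | d dvd q. of_int (moebius_mu d) * (\<Sum>a | a \<in> A \<and> int d dvd a. f a))"
    using assms by (intro sum.cong refl) (auto simp: sum_distrib_left if_distrib[of "\<lambda>x. x * _"]
        simp flip: sum.inter_filter cong: if_cong)
  finally show ?thesis .
qed

lemma sum_coprime_moebius_nat:
  fixes f :: "nat \<Rightarrow> real"
  assumes q: "q > 0"
  shows "(\<Sum>m | m \<in> {1..z} \<and> coprime m q. f m)
    = (\<Sum>d | d dvd q. of_int (moebius_mu d) * (\<Sum>k\<in>{1..z div d}. f (d * k)))"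
proof -
  have "(\<Sum>m | m \<in> {1..z} \<and> coprime m q. f m)
      = (\<Sum>a | a \<in> {1..int z} \<and> coprime a (int q). f (nat a))"
    by (rule sum.reindex_bij_witness[of _ nat int])
      (auto simp: nat_le_iff simp del: coprime_int_iff simp flip: coprime_int_iff)
  also have "\<dots> = (\<Sum>d | d dvd q. of_int (moebius_mu d) * (\<Sum>a | a \<in> {1..int z} \<and> int d dvd a. f (nat a)))"
    using q by (intro sum_coprime_moebius) auto
  also have "\<dots> = (\<Sum>d | d dvd q. of_int (moebius_mu d) * (\<Sum>k\<in>{1..z div d}. f (d * k)))"
  proof (intro sum.cong refl arg_cong2[where f = "(*)"])
    fix d assume "d \<in> {d. d dvd q}"
    then have d0: "d > 0" using q by (auto intro: Nat.gr0I)
    show "(\<Sum>a | a \<in> {1..int z} \<and> int d dvd a. f (nat a)) = (\<Sum>k\<in>{1..z div d}. f (d * k))"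
    proof (rule sum.reindex_bij_witness[of _ "\<lambda>k. int (d * k)" "\<lambda>a. nat a div d"])
      fix a assume a: "a \<in> {a \<in> {1..int z}. int d dvd a}"
      then obtain k where k: "a = int d * k" by auto
      have "0 < int d * k" using a k by simp
      then have "k > 0" using d0 zero_less_mult_pos[of "int d" k] by simp
      then obtain j where j: "k = int j" using zero_less_imp_eq_int by blast
      have aj: "a = int (d * j)" using k j by simp
      then have na: "nat a = d * j" by (metis nat_int)
      then show "int (d * (nat a div d)) = a" using aj d0 by simp
      then show "f (d * (nat a div d)) = f (nat a)" by (metis nat_int)
      have "j \<ge> 1" "d * j \<le> z" using na a \<open>k > 0\<close> j by auto
      then show "nat a div d \<in> {1..z div d}" using na d0
        by (simp add: less_eq_div_iff_mult_less_eq mult.commute)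
    next
      fix k assume "k \<in> {1..z div d}"
      then show "nat (int (d * k)) div d = k" "int (d * k) \<in> {a \<in> {1..int z}. int d dvd a}"
        using d0 by (auto simp: less_eq_div_iff_mult_less_eq mult.commute simp flip: of_nat_mult)
    qed
  qed
  finally show ?thesis .
qed

text \<open>Sieving \<open>{1..q}\<close> itself involves no rounding, since \<open>q div d\<close>
  is exact for every divisor \<open>d\<close>.\<close>

lemma totient_conv_moebius:
  assumes "q > 0"
  shows "real (totient q) / real q = (\<Sum>d | d dvd q. of_int (moebius_mu d) / real d)"
proof -
  have "totatives q = {m. m \<in> {1..q} \<and> coprime m q}" by (auto simp: totatives_def)
  then have "real (totient q) = (\<Sum>m | m \<in> {1..q} \<and> coprime m q. 1)"
    by (simp add: totient_def)
  also have "\<dots> = (\<Sum>d | d dvd q. of_int (moebius_mu d) * real (q div d))"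
    using assms by (subst sum_coprime_moebius_nat) auto
  also have "\<dots> = (\<Sum>d | d dvd q. of_int (moebius_mu d) / real d * real q)"
    by (intro sum.cong) (auto simp: real_of_nat_div)
  also have "\<dots> = (\<Sum>d | d dvd q. of_int (moebius_mu d) / real d) * real q"
    by (simp only: sum_distrib_right)
  finally show ?thesis using assms by simp
qed

section \<open>Additive characters\<close>

text \<open>Shifting by half the modulus before and after \<open>mod\<close> centres the range of
  remainders at 0, so the absolute value is the distance from \<open>k\<close> to the nearest
  multiple of \<open>q\<close>.\<close>

definition centred_residue :: "nat \<Rightarrow> int \<Rightarrow> int" where
  "centred_residue q k = (k + int q div 2) mod int q - int q div 2"

lemma centred_residue_cong: "[centred_residue q k = k] (mod int q)"
  unfolding centred_residue_def cong_def by (simp add: mod_diff_left_eq)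

lemma centred_residue_eq_iff:
  "centred_residue q k = centred_residue q l \<longleftrightarrow> [k = l] (mod int q)"
proof
  assume "centred_residue q k = centred_residue q l"
  then show "[k = l] (mod int q)"
    using centred_residue_cong[of q k] centred_residue_cong[of q l] by (metis cong_sym cong_trans)
next
  assume "[k = l] (mod int q)"
  then have "[k + int q div 2 = l + int q div 2] (mod int q)" by (simp add: cong_add)
  then show "centred_residue q k = centred_residue q l"
    by (simp add: centred_residue_def cong_def)
qed

lemma abs_centred_residue_le: "q > 0 \<Longrightarrow> 2 * \<bar>centred_residue q k\<bar> \<le> int q"
proof -
  assume q: "q > 0"
  then have "0 \<le> (k + int q div 2) mod int q" "(k + int q div 2) mod int q < int q" by auto
  moreover have "2 * (int q div 2) \<le> int q" "int q \<le> 2 * (int q div 2) + 1" by linarith+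
  ultimately show ?thesis unfolding centred_residue_def by (smt (verit))
qed

lemma centred_residue_0_iff: "q > 0 \<Longrightarrow> centred_residue q k = 0 \<longleftrightarrow> int q dvd k"
proof -
  assume q: "q > 0"
  have "centred_residue q 0 = 0" using q by (simp add: centred_residue_def)
  then show ?thesis using centred_residue_eq_iff[of q k 0] by (simp add: cong_0_iff)
qed

section \<open>Additive characters and geometric progressions\<close>

text \<open>The additive character usually written e(k/q), with an integer argument so that negative
  frequencies are available.\<close>

definition root_cis :: "nat \<Rightarrow> int \<Rightarrow> complex" where
  "root_cis q k = cis (2 * pi * of_int k / of_nat q)"

lemma root_cis_0 [simp]: "root_cis q 0 = 1" by (simp add: root_cis_def)

lemma norm_root_cis [simp]: "norm (root_cis q k) = 1" by (simp add: root_cis_def)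

lemma root_cis_add: "root_cis q (k + l) = root_cis q k * root_cis q l"
  by (simp add: root_cis_def cis_mult ring_distribs add_divide_distrib)

lemma root_cis_mult_nat: "root_cis q (k * int n) = root_cis q k ^ n"
  unfolding root_cis_def Complex.DeMoivre by (simp add: mult_ac)

lemma cnj_root_cis: "cnj (root_cis q k) = root_cis q (- k)"
  by (simp add: root_cis_def cis_cnj)

lemma root_cis_cong:
  assumes "q > 0" "[k = l] (mod int q)"
  shows "root_cis q k = root_cis q l"
proof -
  obtain j where j: "k = l + int q * j"
    using assms(2) by (metis cong_iff_lin cong_sym)
  have "root_cis q (int q * j) = cis (2 * pi * of_int j)"
    using assms by (simp add: root_cis_def mult.assoc del: cis_multiple_2pi)
  also have "\<dots> = 1" by (rule cis_multiple_2pi) (rule Ints_of_int)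
  finally show ?thesis using j by (simp add: root_cis_add)
qed

text \<open>A weak form of Jordan's inequality: since \<open>\<bar>x\<bar> \<le> 2\<close>, the
  cubic Taylor remainder is at most two thirds of \<open>\<bar>x\<bar>\<close>.\<close>

lemma abs_sin_ge:
  fixes x :: real
  assumes "\<bar>x\<bar> \<le> pi / 2"
  shows "\<bar>x\<bar> / 3 \<le> \<bar>sin x\<bar>"
proof -
  have x2: "\<bar>x\<bar> \<le> 2" using assms pi_less_4 by linarith
  have "\<bar>sin x - (\<Sum>m<3. sin_coeff m * x ^ m)\<bar> \<le> inverse (fact 3) * \<bar>x\<bar> ^ 3"
    by (rule Maclaurin_sin_bound)
  moreover have "(\<Sum>m<3. sin_coeff m * x ^ m) = x"
    by (simp add: numeral_3_eq_3 sin_coeff_def)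
  ultimately have "\<bar>sin x - x\<bar> \<le> \<bar>x\<bar> ^ 3 / 6"
    by (simp add: fact_numeral inverse_eq_divide)
  also have "\<bar>x\<bar> ^ 3 = \<bar>x\<bar> * \<bar>x\<bar> ^ 2" by (simp add: power3_eq_cube power2_eq_square)
  also have "\<dots> \<le> \<bar>x\<bar> * 2 ^ 2" using x2 by (intro mult_left_mono power_mono) auto
  finally have "\<bar>sin x - x\<bar> \<le> \<bar>x\<bar> * 2 ^ 2 / 6" by simp
  then show ?thesis by (simp add: field_simps) (smt (verit))
qed

text \<open>The chord from 1 to the root of unity has length \<open>2 * \<bar>sin x\<bar>\<close>
  with \<open>x = pi * c / q\<close>, and \<open>\<bar>x\<bar> \<le> pi / 2\<close> because
  \<open>c\<close> is centred. The loss of 3 in the sine bound is covered by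
  \<open>pi > 3\<close>.\<close>

lemma norm_1_minus_root_cis_ge:
  assumes "q > 0"
  shows "2 * \<bar>of_int (centred_residue q k)\<bar> / of_nat q \<le> norm (root_cis q k - 1)"
proof -
  define c where "c = centred_residue q k"
  define x where "x = pi * of_int c / of_nat q"
  have c2: "2 * \<bar>real_of_int c\<bar> \<le> real q"
    using abs_centred_residue_le[OF assms, of k] unfolding c_def by linarith
  have "\<bar>x\<bar> = pi * (\<bar>of_int c\<bar> / of_nat q)" by (simp add: x_def abs_mult)
  moreover have "\<bar>of_int c\<bar> / of_nat q \<le> (1 / 2 :: real)" using c2 assms by (simp add: field_simps)
  ultimately have x: "\<bar>x\<bar> \<le> pi / 2" using pi_gt_zero by (metis mult_left_mono less_imp_le times_divide_eq_right mult.right_neutral)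
  have "root_cis q k = root_cis q c"
    using root_cis_cong[OF assms cong_sym[OF centred_residue_cong]] by (simp add: c_def)
  also have "\<dots> = exp (\<i> * of_real (2 * x))"
    by (simp add: root_cis_def x_def cis_conv_exp mult_ac)
  finally have "norm (root_cis q k - 1) = 2 * \<bar>sin x\<bar>"
    using dist_exp_i_1[of "2 * x"] by simp
  moreover have "\<bar>x\<bar> / 3 \<le> \<bar>sin x\<bar>" using abs_sin_ge[OF x] .
  moreover have "3 * (\<bar>of_int c\<bar> / of_nat q) \<le> \<bar>x\<bar>"
    unfolding \<open>\<bar>x\<bar> = _\<close> using pi_gt3 by (intro mult_right_mono) auto
  ultimately show ?thesis by (simp add: c_def)
qed

text \<open>A geometric progression: its sum times \<open>z - 1\<close> telescopes to a difference
  of two numbers of norm 1, and \<open>norm (z - 1)\<close> is bounded below by the chord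
  estimate.\<close>

lemma norm_sum_root_cis_le:
  assumes q: "q > 0" and k: "\<not> int q dvd k"
  shows "norm (\<Sum>n = 1..Y. root_cis q (k * int n)) \<le> real q / \<bar>of_int (centred_residue q k)\<bar>"
proof -
  define z where "z = root_cis q k"
  define c where "c = \<bar>real_of_int (centred_residue q k)\<bar>"
  have c0: "c > 0" using k centred_residue_0_iff[OF q, of k] unfolding c_def by simp
  have lb: "2 * c / real q \<le> norm (z - 1)"
    using norm_1_minus_root_cis_ge[OF q, of k] by (simp add: c_def z_def)
  have "(z - 1) * (\<Sum>n = 1..Y. z ^ n) = z ^ Suc Y - z"
    by (induction Y) (simp_all add: algebra_simps)
  then have "norm (z - 1) * norm (\<Sum>n = 1..Y. z ^ n) = norm (z ^ Suc Y - z)"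
    by (metis norm_mult)
  also have "\<dots> \<le> norm (z ^ Suc Y) + norm z" by (rule norm_triangle_ineq4)
  also have "\<dots> = 2" by (simp add: z_def norm_power norm_mult)
  finally have "norm (z - 1) * norm (\<Sum>n = 1..Y. z ^ n) \<le> 2" .
  moreover have "2 * c / real q * norm (\<Sum>n = 1..Y. z ^ n) \<le> norm (z - 1) * norm (\<Sum>n = 1..Y. z ^ n)"
    using lb by (intro mult_right_mono) auto
  ultimately have "2 * c / real q * norm (\<Sum>n = 1..Y. z ^ n) \<le> 2" by linarith
  then have "norm (\<Sum>n = 1..Y. z ^ n) \<le> real q / c"
    using c0 q by (simp add: field_simps)
  then show ?thesis by (simp add: root_cis_mult_nat z_def c_def)
qed

text \<open>Translating by \<open>B\<close> only multiplies the sum by a number of norm 1, and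
  conjugation reverses the sign of the frequency, so the geometric bound carries over. The other
  bound is the number of terms.\<close>

lemma norm_sum_interval_root_cis_le:
  assumes q: "q > 0" and k: "\<not> int q dvd k"
  shows "norm (\<Sum>a\<in>{B + 1..B + int L}. root_cis q (- (k * a)))
    \<le> min (real L) (real q / \<bar>of_int (centred_residue q k)\<bar>)"
proof -
  have "(\<Sum>a\<in>{B + 1..B + int L}. root_cis q (k * a))
      = (\<Sum>n = 1..L. root_cis q (k * B) * root_cis q (k * int n))"
    by (rule sum.reindex_bij_witness[of _ "\<lambda>n. B + int n" "\<lambda>a. nat (a - B)"])
       (auto simp: root_cis_add[symmetric] ring_distribs)
  also have "\<dots> = root_cis q (k * B) * (\<Sum>n = 1..L. root_cis q (k * int n))"
    by (simp add: sum_distrib_left)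
  finally have "norm (\<Sum>a\<in>{B + 1..B + int L}. root_cis q (k * a))
      = norm (\<Sum>n = 1..L. root_cis q (k * int n))" by (simp add: norm_mult)
  also have "\<dots> \<le> real q / \<bar>of_int (centred_residue q k)\<bar>"
    by (rule norm_sum_root_cis_le[OF q k])
  finally have "norm (\<Sum>a\<in>{B + 1..B + int L}. root_cis q (k * a))
      \<le> real q / \<bar>of_int (centred_residue q k)\<bar>" .
  moreover have "(\<Sum>a\<in>{B + 1..B + int L}. root_cis q (- (k * a)))
      = cnj (\<Sum>a\<in>{B + 1..B + int L}. root_cis q (k * a))"
    by (simp add: cnj_root_cis)
  then have "norm (\<Sum>a\<in>{B + 1..B + int L}. root_cis q (- (k * a)))
      = norm (\<Sum>a\<in>{B + 1..B + int L}. root_cis q (k * a))" by (simp only: complex_mod_cnj)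
  moreover have "norm (\<Sum>a\<in>{B + 1..B + int L}. root_cis q (- (k * a))) \<le> real L"
    using norm_sum[of "\<lambda>a. root_cis q (- (k * a))" "{B + 1..B + int L}"] by simp
  ultimately show ?thesis by simp
qed

section \<open>Detecting the congruence by characters\<close>

lemma sum_root_cis_orthogonal:
  assumes q: "q > 0"
  shows "(\<Sum>h<q. root_cis q (int h * k)) = (if int q dvd k then of_nat q else 0)"
proof (cases "int q dvd k")
  case True
  then have "root_cis q (int h * k) = 1" for h
    using root_cis_cong[OF q, of "int h * k" 0] by (simp add: cong_0_iff)
  then show ?thesis using True by simp
next
  case False
  define z where "z = root_cis q k"
  have "z ^ q = root_cis q (k * int q)" by (simp add: z_def root_cis_mult_nat)
  also have "\<dots> = root_cis q 0" by (rule root_cis_cong[OF q]) (simp add: cong_0_iff)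
  finally have zq: "z ^ q = 1" by simp
  have "0 < 2 * \<bar>of_int (centred_residue q k)\<bar> / real q"
    using False centred_residue_0_iff[OF q, of k] q by simp
  then have "z \<noteq> 1" using norm_1_minus_root_cis_ge[OF q, of k] by (auto simp: z_def)
  then have "(\<Sum>h<q. z ^ h) = 0" using zq by (simp add: geometric_sum)
  then show ?thesis using False by (simp add: z_def root_cis_mult_nat mult.commute)
qed

text \<open>Orthogonality turns the count into a sum over frequencies \<open>h\<close>, and for each
  \<open>h\<close> the sums over \<open>n\<close> and \<open>a\<close> separate into two geometric
  progressions.\<close>

lemma interval_count_error:
  fixes B :: int
  assumes q: "q > 0" and m: "coprime m q"
  shows "\<bar>(\<Sum>n = 1..Y. \<Sum>a\<in>{B + 1..B + int L}. of_bool ([int (m * n) = a] (mod int q)))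
            - real Y * real L / real q\<bar>
    \<le> (\<Sum>h\<in>{1..<q}. min (real L) (real q / \<bar>of_int (centred_residue q (int h))\<bar>)
          / \<bar>of_int (centred_residue q (int h * int m))\<bar>)"
    (is "\<bar>?N - _\<bar> \<le> (\<Sum>h\<in>_. ?b h)")
proof -
  let ?I = "{B + 1..B + int L}"
  define F :: "nat \<Rightarrow> complex" where "F h = (\<Sum>n = 1..Y. root_cis q (int h * int m * int n)) *
    (\<Sum>a\<in>?I. root_cis q (- (int h * a)))" for h
  have "of_nat q * complex_of_real ?N
      = (\<Sum>n = 1..Y. \<Sum>a\<in>?I. \<Sum>h<q. root_cis q (int h * (int (m * n) - a)))"
    unfolding sum_root_cis_orthogonal[OF q]
    unfolding of_real_sum sum_distrib_left
    by (intro sum.cong refl) (simp add: cong_iff_dvd_diff)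
  also have "\<dots> = (\<Sum>n = 1..Y. \<Sum>h<q. \<Sum>a\<in>?I. root_cis q (int h * (int (m * n) - a)))"
    by (intro sum.cong refl sum.swap)
  also have "\<dots> = (\<Sum>h<q. \<Sum>n = 1..Y. \<Sum>a\<in>?I. root_cis q (int h * (int (m * n) - a)))"
    by (rule sum.swap)
  also have "\<dots> = (\<Sum>h<q. F h)"
    unfolding F_def sum_product
    by (intro sum.cong refl) (simp add: root_cis_add[symmetric] algebra_simps)
  \<comment> \<open>The frequency 0 yields the expected value \<open>Y * L / q\<close>; the others
    form the error.\<close>
  also have "{..<q} = insert 0 {1..<q}" using q by auto
  also have "(\<Sum>h\<in>insert 0 {1..<q}. F h) = of_nat Y * of_nat L + (\<Sum>h\<in>{1..<q}. F h)"
    by (subst sum.insert) (auto simp: F_def)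
  finally have "complex_of_real (real q * (?N - real Y * real L / real q)) = (\<Sum>h\<in>{1..<q}. F h)"
    using q by (simp add: field_simps)
  from arg_cong[OF this, of norm]
  have "real q * \<bar>?N - real Y * real L / real q\<bar> = norm (\<Sum>h\<in>{1..<q}. F h)"
    unfolding norm_of_real abs_mult by simp
  also have "\<dots> \<le> (\<Sum>h\<in>{1..<q}. norm (F h))" by (rule norm_sum)
  also have "\<dots> \<le> (\<Sum>h\<in>{1..<q}. real q * ?b h)"
  proof (intro sum_mono)
    fix h assume h: "h \<in> {1..<q}"
    have h1: "\<not> int q dvd int h" using h by (auto dest: zdvd_imp_le)
    \<comment> \<open>Coprimality of \<open>m\<close> and \<open>q\<close> keeps the frequency
      \<open>h * m\<close> nonzero modulo \<open>q\<close>, so the geometric bound applies to the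
      sum over \<open>n\<close> as well.\<close>
    have h2: "\<not> int q dvd int h * int m"
    proof
      assume "int q dvd int h * int m"
      then have "q dvd h * m" by (simp flip: of_nat_mult)
      then have "q dvd h" using m by (simp add: coprime_commute coprime_dvd_mult_left_iff)
      then show False using h1 by simp
    qed
    have "norm (F h) \<le> real q / \<bar>of_int (centred_residue q (int h * int m))\<bar>
        * min (real L) (real q / \<bar>of_int (centred_residue q (int h))\<bar>)"
      unfolding F_def norm_mult
      by (intro mult_mono norm_sum_root_cis_le[OF q h2] norm_sum_interval_root_cis_le[OF q h1]) auto
    then show "norm (F h) \<le> real q * ?b h" by (simp add: mult_ac)
  qed
  also have "\<dots> = real q * (\<Sum>h\<in>{1..<q}. ?b h)" by (simp only: sum_distrib_left)
  finally show ?thesis using q by simp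
qed

section \<open>Products in an interval, on average\<close>

lemma harm_le_1_plus_ln: "n > 0 \<Longrightarrow> harm n \<le> 1 + ln (real n)"
  using euler_mascheroni_sequence_decreasing[of 1 n] by (simp add: harm_expand)

lemma sum_inverse_abs_int:
  "(\<Sum>u\<in>{- int N..int N} - {0}. 1 / \<bar>real_of_int u\<bar>) = 2 * harm N"
proof -
  have pos: "(\<Sum>u\<in>{1..int N}. 1 / \<bar>real_of_int u\<bar>) = harm N"
    unfolding harm_def
    by (rule sum.reindex_bij_witness[of _ int nat]) (auto simp: inverse_eq_divide nat_le_iff)
  have "(\<Sum>u\<in>{- int N..-1}. 1 / \<bar>real_of_int u\<bar>) = (\<Sum>u\<in>{1..int N}. 1 / \<bar>real_of_int u\<bar>)"
    by (rule sum.reindex_bij_witness[of _ uminus uminus]) auto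
  moreover have "{- int N..int N} - {0} = {- int N..-1} \<union> {1..int N}" by auto
  ultimately show ?thesis using pos by (simp add: sum.union_disjoint)
qed

text \<open>Write \<open>h * m = k * q + u\<close> with \<open>h\<close> and \<open>u\<close> centred modulo \<open>q\<close>. The pair \<open>(k, u)\<close> determines the
  product \<open>h * m \<noteq> 0\<close>, hence \<open>(h, m)\<close> up to a divisor function; and \<open>k \<noteq> 0\<close> forces \<open>q / \<bar>h\<bar> \<le> 2 * m / \<bar>k\<bar>\<close>.\<close>

lemma sum_min_centred_residue_le:
  fixes L Z :: nat and T :: real
  assumes q: "q > 0" and T0: "T \<ge> 0"
    and T: "\<And>w. 0 < w \<Longrightarrow> w \<le> q * Z \<Longrightarrow> real (tau w) \<le> T"
  shows "(\<Sum>m | m \<in> {1..Z} \<and> coprime m q. \<Sum>h\<in>{1..<q}.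
      min (real L) (real q / \<bar>of_int (centred_residue q (int h))\<bar>)
          / \<bar>of_int (centred_residue q (int h * int m))\<bar>)
    \<le> T * ((real L + 4 * real Z * harm Z) * (2 * harm q))"
proof -
  define P where "P = {m. m \<in> {1..Z} \<and> coprime m q} \<times> {1..<q}"
  define c where "c = centred_residue q"
  define u where "u = (\<lambda>(m, h). c (int h * int m))"
  define k where "k = (\<lambda>(m, h). (c (int h) * int m - u (m, h)) div int q)"
  \<comment> \<open>Majorant of the minimum that depends only on the quotient \<open>k\<close>: the
    trivial bound for \<open>k = 0\<close>, and otherwise the bound that
    \<open>q / \<bar>h\<bar>\<close> obeys, with \<open>m\<close> replaced by
    \<open>Z\<close>.\<close>
  define F where "F j = (if j = 0 then real L else 2 * real Z / \<bar>of_int j\<bar>)" for j :: int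
  define KU where "KU = {- int Z..int Z} \<times> ({- int q..int q} - {0})"
  have finP: "finite P" unfolding P_def by auto
  have c_le: "2 * \<bar>c x\<bar> \<le> int q" for x using abs_centred_residue_le[OF q] by (simp add: c_def)
  have hm: "\<not> int q dvd int h" "\<not> int q dvd int h * int m" if "(m, h) \<in> P" for m h
  proof -
    show h1: "\<not> int q dvd int h" using that by (auto simp: P_def dest: zdvd_imp_le)
    show "\<not> int q dvd int h * int m"
    proof
      assume "int q dvd int h * int m"
      then have "q dvd h * m" by (simp flip: of_nat_mult)
      moreover have "coprime q m" using that by (auto simp: P_def coprime_commute)
      ultimately have "q dvd h" by (simp add: coprime_dvd_mult_left_iff)
      then show False using h1 by simp
    qed
  qed
  have ch0: "c (int h) \<noteq> 0" and u0: "u (m, h) \<noteq> 0" if "(m, h) \<in> P" for m h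
    using hm[OF that] centred_residue_0_iff[OF q] by (auto simp: c_def u_def)
  have ku: "c (int h) * int m = k (m, h) * int q + u (m, h)" for m h
  proof -
    have "[c (int h) * int m = u (m, h)] (mod int q)"
      unfolding u_def c_def
      using cong_mult[OF centred_residue_cong[of q "int h"] cong_refl[of "int m"]]
        centred_residue_cong[of q "int h * int m"] by (auto intro: cong_trans cong_sym)
    then have "int q dvd c (int h) * int m - u (m, h)" by (simp add: cong_iff_dvd_diff)
    then show ?thesis by (simp add: k_def)
  qed
  have w_le: "\<bar>c (int h) * int m\<bar> \<le> int (q * Z)" if "(m, h) \<in> P" for m h
  proof -
    have "\<bar>c (int h)\<bar> * int m \<le> int q * int Z"
      using that c_le[of "int h"] by (intro mult_mono) (auto simp: P_def)
    then show ?thesis by (simp add: abs_mult)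
  qed
  \<comment> \<open>For \<open>k \<noteq> 0\<close> the remainder satisfies
    \<open>\<bar>u\<bar> \<le> q / 2 \<le> \<bar>k\<bar> * q / 2\<close>, so it is absorbed at the
    cost of a factor 2.\<close>
  have kbound: "\<bar>k (m, h)\<bar> * int q \<le> 2 * (\<bar>c (int h)\<bar> * int m)" for m h
  proof (cases "k (m, h) = 0")
    case False
    have "\<bar>k (m, h)\<bar> * int q = \<bar>c (int h) * int m - u (m, h)\<bar>"
      using ku[of h m] by (simp add: abs_mult)
    also have "\<dots> \<le> \<bar>c (int h)\<bar> * int m + \<bar>u (m, h)\<bar>"
      by (metis abs_triangle_ineq4 abs_mult abs_of_nat)
    finally have "\<bar>k (m, h)\<bar> * int q \<le> \<bar>c (int h)\<bar> * int m + \<bar>u (m, h)\<bar>" .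
    moreover have "2 * \<bar>u (m, h)\<bar> \<le> int q" using c_le by (simp add: u_def)
    moreover have "1 * int q \<le> \<bar>k (m, h)\<bar> * int q" using False by (intro mult_right_mono) auto
    ultimately show ?thesis by linarith
  qed simp
  have inKU: "(k x, u x) \<in> KU" if "x \<in> P" for x
  proof -
    obtain m h where x: "x = (m, h)" by fastforce
    have "\<bar>k (m, h)\<bar> * int q \<le> int m * (2 * \<bar>c (int h)\<bar>)" using kbound[of m h] by (simp add: mult_ac)
    also have "\<dots> \<le> int Z * int q"
      using that c_le[of "int h"] x by (intro mult_mono) (auto simp: P_def)
    finally have "\<bar>k (m, h)\<bar> \<le> int Z" using q by simp
    moreover have "\<bar>u (m, h)\<bar> \<le> int q" using c_le[of "int h * int m"] by (simp add: u_def)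
    ultimately show ?thesis using u0[of m h] that x by (auto simp: KU_def)
  qed
  have term_le: "min (real L) (real q / \<bar>of_int (c (int h))\<bar>) \<le> F (k (m, h))" if "(m, h) \<in> P" for m h
  proof (cases "k (m, h) = 0")
    case False
    have "real_of_int (\<bar>k (m, h)\<bar> * int q) \<le> real_of_int (2 * (\<bar>c (int h)\<bar> * int m))"
      using kbound[of m h] by (simp only: of_int_le_iff)
    then have "\<bar>real_of_int (k (m, h))\<bar> * real q \<le> 2 * (\<bar>real_of_int (c (int h))\<bar> * real m)" by simp
    also have "\<dots> \<le> 2 * (\<bar>real_of_int (c (int h))\<bar> * real Z)"
      using that by (intro mult_left_mono) (auto simp: P_def)
    finally have "real q / \<bar>real_of_int (c (int h))\<bar> \<le> 2 * real Z / \<bar>real_of_int (k (m, h))\<bar>"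
      using False ch0[OF that] by (simp add: field_simps)
    then show ?thesis using False by (simp add: F_def)
  qed (simp add: F_def)
  \<comment> \<open>A pair \<open>(k, u)\<close> fixes the nonzero product \<open>k * q + u\<close>
    of the centred \<open>h\<close> with \<open>m\<close>. Hence \<open>m\<close> divides a fixed
    \<open>w\<close>, and \<open>m\<close> then determines \<open>h\<close>; the fibre has at most
    \<open>tau w\<close> elements.\<close>
  have fibre: "real (card {x \<in> P. (k x, u x) = y}) \<le> T" if "y \<in> KU" for y
  proof (cases "{x \<in> P. (k x, u x) = y} = {}")
    case True
    then show ?thesis using T0 by (simp only: card.empty of_nat_0)
  next
    case False
    then obtain m0 h0 where m0: "(m0, h0) \<in> P" "(k (m0, h0), u (m0, h0)) = y" by auto
    define w where "w = nat \<bar>c (int h0) * int m0\<bar>"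
    have w0: "w > 0" using ch0[OF m0(1)] m0(1) by (auto simp: w_def P_def)
    have wle: "w \<le> q * Z" using w_le[OF m0(1)] unfolding w_def by linarith
    have same: "c (int h) * int m = c (int h0) * int m0" if "(m, h) \<in> P" "(k (m, h), u (m, h)) = y" for m h
      using ku[of h m] ku[of h0 m0] that m0 by auto
    have "inj_on fst {x \<in> P. (k x, u x) = y}"
    proof (rule inj_onI)
      fix x x' assume "x \<in> {x \<in> P. (k x, u x) = y}" "x' \<in> {x \<in> P. (k x, u x) = y}" "fst x = fst x'"
      moreover obtain m h where x: "x = (m, h)" by fastforce
      moreover obtain m' h' where x': "x' = (m', h')" by fastforce
      ultimately have A: "(m, h) \<in> P" "(k (m, h), u (m, h)) = y" "(m', h') \<in> P"
        "(k (m', h'), u (m', h')) = y" "m = m'" by auto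
      have "c (int h) * int m = c (int h') * int m" using same[of m h] same[of m' h'] A by auto
      then have "c (int h) = c (int h')" using A(1) by (auto simp: P_def)
      then have "[h = h'] (mod q)" by (simp add: c_def centred_residue_eq_iff cong_int_iff)
      then have "h = h'" using A by (auto simp: P_def cong_def)
      then show "x = x'" using A x x' by simp
    qed
    moreover have "fst ` {x \<in> P. (k x, u x) = y} \<subseteq> {d. d dvd w}"
    proof (rule image_subsetI)
      fix x assume "x \<in> {x \<in> P. (k x, u x) = y}"
      moreover obtain m h where x: "x = (m, h)" by fastforce
      ultimately have "(m, h) \<in> P" "(k (m, h), u (m, h)) = y" by auto
      then have "int m dvd c (int h0) * int m0" using same[of m h] by (metis dvd_triv_right)
      then have "m dvd w" using dvd_abs_iff[of "int m"] by (simp add: w_def nat_dvd_iff dvd_nat_abs_iff)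
      then show "fst x \<in> {d. d dvd w}" by (simp add: x)
    qed
    ultimately have "card {x \<in> P. (k x, u x) = y} \<le> tau w"
      unfolding tau_def using w0 by (intro card_inj_on_le[of fst]) auto
    then show ?thesis using T[OF w0 wle] by linarith
  qed
  have F0: "F j \<ge> 0" for j by (simp add: F_def)
  have "(\<Sum>m | m \<in> {1..Z} \<and> coprime m q. \<Sum>h\<in>{1..<q}.
      min (real L) (real q / \<bar>of_int (c (int h))\<bar>) / \<bar>of_int (c (int h * int m))\<bar>)
    = (\<Sum>(m, h)\<in>P. min (real L) (real q / \<bar>of_int (c (int h))\<bar>) / \<bar>of_int (u (m, h))\<bar>)"
    unfolding P_def u_def by (subst sum.cartesian_product) simp
  also have "\<dots> \<le> (\<Sum>x\<in>P. (\<lambda>(j, v). F j * (1 / \<bar>of_int v\<bar>)) (k x, u x))"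
    using term_le by (intro sum_mono) (auto intro!: divide_right_mono)
  \<comment> \<open>The summand depends on \<open>(k, u)\<close> alone, so terms are grouped by
    fibres. After the fibre bound, the sum over the box \<open>KU\<close> factors into two harmonic
    sums.\<close>
  also have "\<dots> = (\<Sum>y\<in>KU. real (card {x \<in> P. (k x, u x) = y}) * (\<lambda>(j, v). F j * (1 / \<bar>of_int v\<bar>)) y)"
    using inKU finP by (intro sum_fun_comp) (auto simp: KU_def)
  also have "\<dots> \<le> (\<Sum>y\<in>KU. T * (\<lambda>(j, v). F j * (1 / \<bar>of_int v\<bar>)) y)"
    using fibre F0 by (intro sum_mono mult_right_mono) auto
  also have "\<dots> = T * ((\<Sum>j\<in>{- int Z..int Z}. F j) * (\<Sum>v\<in>{- int q..int q} - {0}. 1 / \<bar>of_int v\<bar>))"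
    unfolding KU_def sum_product sum.cartesian_product by (simp add: sum_distrib_left)
  also have "(\<Sum>j\<in>{- int Z..int Z}. F j) = real L + 4 * real Z * harm Z"
  proof -
    have "{- int Z..int Z} = insert 0 ({- int Z..int Z} - {0})" by auto
    then have "(\<Sum>j\<in>{- int Z..int Z}. F j) = F 0 + (\<Sum>j\<in>{- int Z..int Z} - {0}. F j)"
      by (metis Diff_iff finite_atLeastAtMost_int finite_Diff insertI1 sum.insert)
    also have "(\<Sum>j\<in>{- int Z..int Z} - {0}. F j)
        = (\<Sum>j\<in>{- int Z..int Z} - {0}. 2 * real Z * (1 / \<bar>of_int j\<bar>))"
      by (intro sum.cong) (auto simp: F_def)
    also have "\<dots> = 4 * real Z * harm Z"
      unfolding sum_distrib_left[symmetric] sum_inverse_abs_int by simp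
    finally show ?thesis by (simp add: F_def)
  qed
  finally show ?thesis unfolding sum_inverse_abs_int c_def .
qed

lemma sum_interval_count_error_le:
  fixes L Z :: nat and T :: real and B :: int and Y :: "nat \<Rightarrow> nat"
  assumes q: "q > 0" and T0: "T \<ge> 0"
    and T: "\<And>w. 0 < w \<Longrightarrow> w \<le> q * Z \<Longrightarrow> real (tau w) \<le> T"
  shows "(\<Sum>m | m \<in> {1..Z} \<and> coprime m q.
      \<bar>(\<Sum>n = 1..Y m. \<Sum>a\<in>{B + 1..B + int L}. of_bool ([int (m * n) = a] (mod int q)))
            - real (Y m) * real L / real q\<bar>)
    \<le> T * ((real L + 4 * real Z * harm Z) * (2 * harm q))"
proof -
  have "(\<Sum>m | m \<in> {1..Z} \<and> coprime m q.
      \<bar>(\<Sum>n = 1..Y m. \<Sum>a\<in>{B + 1..B + int L}. of_bool ([int (m * n) = a] (mod int q)))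
            - real (Y m) * real L / real q\<bar>)
    \<le> (\<Sum>m | m \<in> {1..Z} \<and> coprime m q. \<Sum>h\<in>{1..<q}.
      min (real L) (real q / \<bar>of_int (centred_residue q (int h))\<bar>)
          / \<bar>of_int (centred_residue q (int h * int m))\<bar>)"
    by (intro sum_mono interval_count_error[OF q]) simp
  also note sum_min_centred_residue_le[OF q T0 T]
  finally show ?thesis .
qed

section \<open>Removing the coprimality condition on the interval\<close>

text \<open>Dividing the multiples of \<open>d\<close> in an interval by \<open>d\<close> leaves an
  interval again, so the character bound stays applicable after sieving.\<close>

lemma multiples_in_interval:
  assumes d: "d > 0"
  shows "bij_betw (\<lambda>b. int d * b)
    {B div int d + 1..B div int d + int (nat ((B + int A) div int d - B div int d))}
    {a \<in> interval B A. int d dvd a}"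
proof -
  have "B div int d \<le> (B + int A) div int d" using d by (intro zdiv_mono1) auto
  then have e: "B div int d + int (nat ((B + int A) div int d - B div int d)) = (B + int A) div int d"
    by simp
  have le_div: "b \<le> C div int d \<longleftrightarrow> int d * b \<le> C" for b C
  proof
    assume "b \<le> C div int d"
    then have "int d * b \<le> int d * (C div int d)" by (intro mult_left_mono) auto
    also have "\<dots> \<le> C" using d by (simp add: mult.commute minus_mod_eq_mult_div[symmetric])
    finally show "int d * b \<le> C" .
  next
    assume "int d * b \<le> C"
    then have "int d * b div int d \<le> C div int d" using d by (intro zdiv_mono1) auto
    then show "b \<le> C div int d" using d by simp
  qed
  have lower: "B div int d + 1 \<le> b \<longleftrightarrow> B + 1 \<le> int d * b" for b
    using le_div[of b B] by linarith
  have upper: "b \<le> (B + int A) div int d \<longleftrightarrow> int d * b \<le> B + int A" for b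
    by (rule le_div)
  show ?thesis unfolding e
    by (rule bij_betwI'[rule_format]) (use d in \<open>auto simp: interval_def lower upper elim!: dvdE\<close>)
qed

lemma multiples_length_le:
  assumes "d > 0"
  shows "nat ((B + int A) div int d - B div int d) \<le> A"
proof -
  have "(B + int A) div int d \<le> (B + int A * int d) div int d"
    using assms by (intro zdiv_mono1) (auto simp: mult_le_cancel_left1)
  also have "\<dots> = B div int d + int A" using assms by simp
  finally show ?thesis by simp
qed

text \<open>Ensures that the density of the shortened interval modulo \<open>q\<close> is at most 1,
  which keeps rounding errors bounded.\<close>

lemma multiples_length_le_modulus:
  assumes "d > 0" "A \<le> d * q"
  shows "nat ((B + int A) div int d - B div int d) \<le> q"
proof -
  have "int A \<le> int q * int d" using assms(2) by (simp add: mult.commute flip: of_nat_mult)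
  then have "(B + int A) div int d \<le> (B + int q * int d) div int d"
    using assms by (intro zdiv_mono1) auto
  also have "\<dots> = B div int d + int q" using assms by simp
  finally show ?thesis by simp
qed

text \<open>Puts the expected value into the same Moebius form as the count, so that the two can be
  compared divisor by divisor.\<close>

lemma card_reduced_part:
  assumes "q > 0"
  shows "real (card (reduced_part (interval B A) q)) = (\<Sum>d | d dvd q.
    of_int (moebius_mu d) * real (nat ((B + int A) div int d - B div int d)))"
proof -
  have "finite (interval B A)" by (simp add: interval_def)
  then have "real (card (reduced_part (interval B A) q))
    = (\<Sum>d | d dvd q. of_int (moebius_mu d) * (\<Sum>a | a \<in> interval B A \<and> int d dvd a. 1))"
    using sum_coprime_moebius[OF assms, of "interval B A" "\<lambda>_. 1"] by (simp add: reduced_part_def)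
  also have "\<dots> = (\<Sum>d | d dvd q.
    of_int (moebius_mu d) * real (nat ((B + int A) div int d - B div int d)))"
  proof (intro sum.cong refl arg_cong2[where f = "(*)"])
    fix d assume "d \<in> {d. d dvd q}"
    then have "d > 0" using assms by (auto intro: Nat.gr0I)
    then show "(\<Sum>a | a \<in> interval B A \<and> int d dvd a. 1) = real (nat ((B + int A) div int d - B div int d))"
      using bij_betw_same_card[OF multiples_in_interval[of d B A]] by (simp split: if_splits)
  qed
  finally show ?thesis .
qed

text \<open>When \<open>d\<close> divides both \<open>q\<close> and \<open>a\<close>, the congruence
  forces \<open>d\<close> to divide \<open>m * n\<close>, hence \<open>n\<close>, as
  \<open>m\<close> is coprime to \<open>q\<close>. Cancelling \<open>d\<close> leaves a congruence
  modulo \<open>q div d\<close>.\<close>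

lemma sum_reduced_part_moebius:
  fixes B :: int
  assumes q: "q > 0" and m: "coprime m q"
  shows "(\<Sum>n = 1..N. \<Sum>a\<in>reduced_part (interval B A) q. of_bool ([int (m * n) = a] (mod int q)))
    = (\<Sum>d | d dvd q. real_of_int (moebius_mu d) *
        (\<Sum>n = 1..N div d. \<Sum>b\<in>{B div int d + 1..B div int d + int (nat ((B + int A) div int d - B div int d))}.
          of_bool ([int (m * n) = b] (mod int (q div d)))))"
proof -
  define J where "J d = {B div int d + 1..B div int d + int (nat ((B + int A) div int d - B div int d))}" for d :: nat
  have fin: "finite (interval B A)" by (simp add: interval_def)
  have "(\<Sum>n = 1..N. \<Sum>a\<in>reduced_part (interval B A) q. of_bool ([int (m * n) = a] (mod int q)))
    = (\<Sum>n = 1..N. \<Sum>d | d dvd q. real_of_int (moebius_mu d) *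
         (\<Sum>a | a \<in> interval B A \<and> int d dvd a. of_bool ([int (m * n) = a] (mod int q))))"
    unfolding reduced_part_def by (intro sum.cong refl sum_coprime_moebius[OF q fin])
  also have "\<dots> = (\<Sum>d | d dvd q. real_of_int (moebius_mu d) *
         (\<Sum>n = 1..N. \<Sum>a | a \<in> interval B A \<and> int d dvd a. of_bool ([int (m * n) = a] (mod int q))))"
    by (subst sum.swap) (simp only: sum_distrib_left)
  also have "\<dots> = (\<Sum>d | d dvd q. real_of_int (moebius_mu d) *
        (\<Sum>n = 1..N div d. \<Sum>b\<in>J d. of_bool ([int (m * n) = b] (mod int (q div d)))))"
  proof (rule sum.cong[OF refl])
    fix d assume d: "d \<in> {d. d dvd q}"
    then have d0: "d > 0" using q by (auto intro: Nat.gr0I)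
    obtain r where r: "q = d * r" using d by auto
    have "(\<Sum>n = 1..N. \<Sum>a | a \<in> interval B A \<and> int d dvd a. of_bool ([int (m * n) = a] (mod int q)))
      = (\<Sum>n = 1..N. \<Sum>b\<in>J d. of_bool ([int (m * n) = int d * b] (mod int q)) :: real)"
      using multiples_in_interval[OF d0, of B A] unfolding J_def
      by (intro sum.cong refl sum.reindex_bij_betw[symmetric]) auto
    also have "\<dots> = (\<Sum>n | n \<in> {1..N} \<and> d dvd n. \<Sum>b\<in>J d. of_bool ([int (m * n) = int d * b] (mod int q)))"
    proof (rule sum.mono_neutral_right)
      show "\<forall>n\<in>{1..N} - {n \<in> {1..N}. d dvd n}.
          (\<Sum>b\<in>J d. of_bool ([int (m * n) = int d * b] (mod int q))) = (0::real)"
      proof (intro ballI sum.neutral)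
        fix n b assume n: "n \<in> {1..N} - {n \<in> {1..N}. d dvd n}"
        have "coprime d m" using m d by (metis coprime_commute coprime_divisors dvd_refl mem_Collect_eq)
        have "\<not> [int (m * n) = int d * b] (mod int q)"
        proof
          assume "[int (m * n) = int d * b] (mod int q)"
          then have "[int (m * n) = int d * b] (mod int d)" using r by (auto intro: cong_modulus_mult)
          then have "int d dvd int (m * n)" using cong_dvd_iff by (metis dvd_triv_left)
          then have "d dvd m * n" by (simp only: int_dvd_int_iff)
          then have "d dvd n" using \<open>coprime d m\<close> by (simp add: coprime_dvd_mult_right_iff)
          then show False using n by auto
        qed
        then show "of_bool ([int (m * n) = int d * b] (mod int q)) = (0::real)" by simp
      qed
    qed auto
    also have "\<dots> = (\<Sum>n = 1..N div d. \<Sum>b\<in>J d. of_bool ([int (m * (d * n)) = int d * b] (mod int q)))"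
      by (rule sum.reindex_bij_witness[of _ "\<lambda>n. d * n" "\<lambda>n. n div d"])
        (use d0 in \<open>auto simp: less_eq_div_iff_mult_less_eq mult.commute Suc_le_eq elim!: dvdE\<close>)
    also have "\<dots> = (\<Sum>n = 1..N div d. \<Sum>b\<in>J d. of_bool ([int (m * n) = b] (mod int (q div d))))"
    proof (intro sum.cong refl arg_cong[where f = of_bool])
      fix n b
      have "[int (m * (d * n)) = int d * b] (mod int q) \<longleftrightarrow> int d * int r dvd int d * (int (m * n) - b)"
        by (simp add: cong_iff_dvd_diff r algebra_simps)
      also have "\<dots> \<longleftrightarrow> [int (m * n) = b] (mod int (q div d))"
        using d0 r by (simp add: cong_iff_dvd_diff)
      finally show "[int (m * (d * n)) = int d * b] (mod int q) \<longleftrightarrow> [int (m * n) = b] (mod int (q div d))" .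
    qed
    finally show "real_of_int (moebius_mu d) *
         (\<Sum>n = 1..N. \<Sum>a | a \<in> interval B A \<and> int d dvd a. of_bool ([int (m * n) = a] (mod int q)))
      = of_int (moebius_mu d) * (\<Sum>n = 1..N div d. \<Sum>b\<in>J d. of_bool ([int (m * n) = b] (mod int (q div d))))"
      by (rule arg_cong)
  qed
  finally show ?thesis unfolding J_def .
qed

lemma nat_floor_div: "y \<ge> 0 \<Longrightarrow> nat \<lfloor>y\<rfloor> div d = nat \<lfloor>y / real d\<rfloor>"
  using floor_divide_real_eq_div[of "int d" y] by (simp add: nat_div_distrib)

lemma abs_nat_floor_div_diff_le:
  fixes y :: real
  assumes "y \<ge> 0"
  shows "\<bar>real (nat \<lfloor>y\<rfloor> div d) - y / real d\<bar> \<le> 1"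
proof -
  have "y / real d \<ge> 0" using assms by simp
  then show ?thesis unfolding nat_floor_div[OF assms] by linarith
qed

text \<open>For each divisor \<open>d\<close> of \<open>q\<close> the averaged interval bound
  applies with modulus \<open>q div d\<close> and an interval no longer than \<open>A\<close>; there
  are \<open>tau q\<close> such divisors.\<close>

lemma sum_reduced_count_error_le:
  fixes A Z :: nat and T :: real and B :: int and y :: "nat \<Rightarrow> real"
  assumes q: "q > 0" and A: "A \<le> q" and T0: "T \<ge> 0"
    and T: "\<And>w. 0 < w \<Longrightarrow> w \<le> q * Z \<Longrightarrow> real (tau w) \<le> T"
    and y: "\<And>m. y m \<ge> 0"
  shows "(\<Sum>m | m \<in> {1..Z} \<and> coprime m q.
      \<bar>(\<Sum>n = 1..nat \<lfloor>y m\<rfloor>. \<Sum>a\<in>reduced_part (interval B A) q. of_bool ([int (m * n) = a] (mod int q)))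
            - real (card (reduced_part (interval B A) q)) / real q * y m\<bar>)
    \<le> real (tau q) * (T * ((real A + 4 * real Z * harm Z) * (2 * harm q)) + real Z)"
proof -
  define Q where "Q = {m. m \<in> {1..Z} \<and> coprime m q}"
  define L where "L d = nat ((B + int A) div int d - B div int d)" for d :: nat
  define c where "c d m = (\<Sum>n = 1..nat \<lfloor>y m\<rfloor> div d. \<Sum>b\<in>{B div int d + 1..B div int d + int (L d)}.
          of_bool ([int (m * n) = b] (mod int (q div d))) :: real)" for d m :: nat
  define K where "K = T * ((real A + 4 * real Z * harm Z) * (2 * harm q))"
  have pointwise: "\<bar>(\<Sum>n = 1..nat \<lfloor>y m\<rfloor>. \<Sum>a\<in>reduced_part (interval B A) q. of_bool ([int (m * n) = a] (mod int q)))
            - real (card (reduced_part (interval B A) q)) / real q * y m\<bar>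
    \<le> (\<Sum>d | d dvd q. \<bar>c d m - real (L d) / real q * y m\<bar>)" (is "\<bar>?s\<bar> \<le> _") if "m \<in> Q" for m
  proof -
    have "coprime m q" using that by (simp add: Q_def)
    then have "?s = (\<Sum>d | d dvd q. of_int (moebius_mu d) * (c d m - real (L d) / real q * y m))"
      unfolding sum_reduced_part_moebius[OF q \<open>coprime m q\<close>] card_reduced_part[OF q] c_def L_def
      by (simp add: sum_subtractf sum_distrib_right sum_divide_distrib right_diff_distrib mult.assoc)
    also have "\<bar>\<dots>\<bar> \<le> (\<Sum>d | d dvd q. \<bar>of_int (moebius_mu d) * (c d m - real (L d) / real q * y m)\<bar>)"
      by (rule sum_abs)
    also have "\<dots> \<le> (\<Sum>d | d dvd q. \<bar>c d m - real (L d) / real q * y m\<bar>)"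
    proof (intro sum_mono)
      fix d
      have "\<bar>real_of_int (moebius_mu d)\<bar> \<le> 1" using abs_moebius_mu_le[of d] by linarith
      then show "\<bar>of_int (moebius_mu d) * (c d m - real (L d) / real q * y m)\<bar> \<le> \<bar>c d m - real (L d) / real q * y m\<bar>"
        unfolding abs_mult by (intro mult_left_le_one_le) auto
    qed
    finally show ?thesis .
  qed
  have per_divisor: "(\<Sum>m\<in>Q. \<bar>c d m - real (L d) / real q * y m\<bar>) \<le> K + real Z" if "d dvd q" for d
  proof -
    have d0: "d > 0" using that q by (auto intro: Nat.gr0I)
    obtain r where r: "q = d * r" using \<open>d dvd q\<close> by blast
    have r0: "r > 0" using r q by auto
    have qd: "q div d = r" using r d0 by simp
    have LA: "L d \<le> A" unfolding L_def by (rule multiples_length_le[OF d0])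
    have Lr: "L d \<le> r" unfolding L_def using A r by (intro multiples_length_le_modulus[OF d0]) auto
    have rq: "r \<le> q" using r d0 by simp
    have "(\<Sum>m\<in>Q. \<bar>c d m - real (L d) / real q * y m\<bar>)
      \<le> (\<Sum>m\<in>Q. \<bar>c d m - real (nat \<lfloor>y m\<rfloor> div d) * real (L d) / real r\<bar> + 1)"
    \<comment> \<open>Replacing the rounded number of \<open>n\<close> by \<open>y m / d\<close>
      changes the expected value by at most \<open>L d / r \<le> 1\<close>, which produces the extra
      \<open>Z\<close> after summation over \<open>m\<close>.\<close>
    proof (intro sum_mono)
      fix m
      have "real (nat \<lfloor>y m\<rfloor> div d) * real (L d) / real r - real (L d) / real q * y m
        = real (L d) / real r * (real (nat \<lfloor>y m\<rfloor> div d) - y m / real d)"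
        using d0 r0 by (simp add: r field_simps)
      then have "\<bar>real (nat \<lfloor>y m\<rfloor> div d) * real (L d) / real r - real (L d) / real q * y m\<bar>
        = real (L d) / real r * \<bar>real (nat \<lfloor>y m\<rfloor> div d) - y m / real d\<bar>"
        by (simp add: abs_mult)
      also have "\<dots> \<le> 1 * 1" using Lr r0 abs_nat_floor_div_diff_le[OF y, of m d]
        by (intro mult_mono) auto
      finally show "\<bar>c d m - real (L d) / real q * y m\<bar>
          \<le> \<bar>c d m - real (nat \<lfloor>y m\<rfloor> div d) * real (L d) / real r\<bar> + 1" by linarith
    qed
    also have "\<dots> = (\<Sum>m\<in>Q. \<bar>c d m - real (nat \<lfloor>y m\<rfloor> div d) * real (L d) / real r\<bar>) + real (card Q)"
      by (simp add: sum.distrib)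
    \<comment> \<open>The sum is enlarged to all \<open>m\<close> coprime to the smaller modulus
      \<open>r\<close>, as the averaged bound is stated for these.\<close>
    also have "(\<Sum>m\<in>Q. \<bar>c d m - real (nat \<lfloor>y m\<rfloor> div d) * real (L d) / real r\<bar>)
      \<le> (\<Sum>m | m \<in> {1..Z} \<and> coprime m r. \<bar>c d m - real (nat \<lfloor>y m\<rfloor> div d) * real (L d) / real r\<bar>)"
      using r by (intro sum_mono2) (auto simp: Q_def)
    also have "\<dots> \<le> T * ((real (L d) + 4 * real Z * harm Z) * (2 * harm r))"
    proof -
      have "real (tau w) \<le> T" if "0 < w" "w \<le> r * Z" for w
      proof -
        have "r * Z \<le> q * Z" using rq by (rule mult_right_mono) simp
        then show ?thesis using T that by (meson order_trans)
      qed
      then show ?thesis unfolding c_def qd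
        by (rule sum_interval_count_error_le[OF r0 T0])
    qed
    also have "\<dots> \<le> K" unfolding K_def
      using T0 LA harm_mono[OF rq] harm_nonneg[of r] harm_nonneg[of Z]
      by (intro mult_left_mono mult_mono add_mono) auto
    also have "card Q \<le> card {1..Z}" by (intro card_mono) (auto simp: Q_def)
    finally show ?thesis by simp
  qed
  have "(\<Sum>m\<in>Q.
      \<bar>(\<Sum>n = 1..nat \<lfloor>y m\<rfloor>. \<Sum>a\<in>reduced_part (interval B A) q. of_bool ([int (m * n) = a] (mod int q)))
            - real (card (reduced_part (interval B A) q)) / real q * y m\<bar>)
    \<le> (\<Sum>m\<in>Q. \<Sum>d | d dvd q. \<bar>c d m - real (L d) / real q * y m\<bar>)"
    by (intro sum_mono pointwise)
  also have "\<dots> = (\<Sum>d | d dvd q. \<Sum>m\<in>Q. \<bar>c d m - real (L d) / real q * y m\<bar>)"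
    by (rule sum.swap)
  also have "\<dots> \<le> (\<Sum>d | d dvd q. K + real Z)"
    by (intro sum_mono per_divisor) simp
  also have "\<dots> = real (tau q) * (K + real Z)" by (simp add: tau_def)
  finally show ?thesis unfolding Q_def K_def .
qed

section \<open>Hyperbola method and main term\<close>

text \<open>With \<open>Z\<close> the integer square root of \<open>N\<close>, every factorisation
  of some \<open>n \<le> N\<close> has a factor at most \<open>Z\<close>. The two regions
  \<open>H1\<close> and \<open>H2\<close> are mirror images, and inclusion-exclusion subtracts their
  overlap.\<close>

lemma sum_tau_hyperbola:
  fixes g :: "nat \<Rightarrow> real"
  assumes Z: "Z ^ 2 \<le> N" "N < (Z + 1) ^ 2"
  shows "(\<Sum>n = 1..N. real (tau n) * g n)
    = 2 * (\<Sum>m = 1..Z. \<Sum>n = 1..N div m. g (m * n)) - (\<Sum>m = 1..Z. \<Sum>n = 1..Z. g (m * n))"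
proof -
  define H1 where "H1 = (SIGMA m:{1..Z}. {1..N div m})"
  define H2 where "H2 = prod.swap ` H1"
  define G where "G = (\<lambda>(m, n). g (m * n))"
  have H1: "(m, n) \<in> H1 \<longleftrightarrow> m \<ge> 1 \<and> n \<ge> 1 \<and> m \<le> Z \<and> m * n \<le> N" for m n
    by (auto simp: H1_def less_eq_div_iff_mult_less_eq mult.commute)
  have H2: "(m, n) \<in> H2 \<longleftrightarrow> m \<ge> 1 \<and> n \<ge> 1 \<and> n \<le> Z \<and> m * n \<le> N" for m n
    unfolding H2_def pair_in_swap_image H1 by (auto simp: mult.commute)
  have fin: "finite H1" "finite H2" by (auto simp: H1_def H2_def)
  have "(\<Sum>n = 1..N. real (tau n) * g n) = (\<Sum>n = 1..N. \<Sum>d | d dvd n. g n)"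
    by (simp add: tau_def)
  also have "\<dots> = (\<Sum>(n, d)\<in>(SIGMA n:{1..N}. {d. d dvd n}). g n)"
    by (subst sum.Sigma) auto
  also have "\<dots> = sum G (H1 \<union> H2)"
  proof (rule sum.reindex_bij_witness[of _ "\<lambda>(m, n). (m * n, m)" "\<lambda>(n, d). (d, n div d)"])
    fix x assume "x \<in> (SIGMA n:{1..N}. {d. d dvd n})"
    then obtain d k where x: "x = (d * k, d)" and dk: "d * k \<ge> 1" "d * k \<le> N" by (auto elim!: dvdE)
    have pos: "d \<ge> 1" "k \<ge> 1" using dk by (auto simp: Suc_le_eq)
    have "d \<le> Z \<or> k \<le> Z"
    proof (rule ccontr)
      assume "\<not> ?thesis"
      then have "(Z + 1) * (Z + 1) \<le> d * k" by (intro mult_mono) auto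
      then show False using dk Z by (simp add: power2_eq_square)
    qed
    then show "(case x of (n, d) \<Rightarrow> (d, n div d)) \<in> H1 \<union> H2"
      using x dk pos H1[of d k] H2[of d k] by auto
    show "(case case x of (n, d) \<Rightarrow> (d, n div d) of (m, n) \<Rightarrow> (m * n, m)) = x"
      "G (case x of (n, d) \<Rightarrow> (d, n div d)) = (case x of (n, d) \<Rightarrow> g n)"
      using x pos by (auto simp: G_def)
  next
    fix x assume "x \<in> H1 \<union> H2"
    moreover obtain m n where x: "x = (m, n)" by fastforce
    ultimately have "m \<ge> 1" "n \<ge> 1" "m * n \<le> N" using H1[of m n] H2[of m n] by auto
    then show "(case case x of (m, n) \<Rightarrow> (m * n, m) of (n, d) \<Rightarrow> (d, n div d)) = x"
      "(case x of (m, n) \<Rightarrow> (m * n, m)) \<in> (SIGMA n:{1..N}. {d. d dvd n})"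
      using x by (auto simp: Suc_le_eq)
  qed
  also have "\<dots> = sum G H1 + sum G H2 - sum G (H1 \<inter> H2)"
    using sum.union_inter[OF fin, of G] by simp
  also have "sum G H2 = sum G H1"
    unfolding H2_def by (subst sum.reindex) (auto simp: G_def mult.commute intro!: sum.cong)
  also have "sum G H1 = (\<Sum>m = 1..Z. \<Sum>n = 1..N div m. g (m * n))"
    unfolding H1_def G_def by (subst sum.Sigma) auto
  \<comment> \<open>The overlap is the full square, since \<open>Z ^ 2 \<le> N\<close> makes the
    condition on the product automatic.\<close>
  also have "H1 \<inter> H2 = {1..Z} \<times> {1..Z}"
  proof -
    have "m * n \<le> N" if "m \<le> Z" "n \<le> Z" for m n
    proof -
      have "m * n \<le> Z * Z" using that by (rule mult_mono) auto
      then show ?thesis using Z by (simp add: power2_eq_square)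
    qed
    then show ?thesis using H1 H2 by auto
  qed
  also have "sum G ({1..Z} \<times> {1..Z}) = (\<Sum>m = 1..Z. \<Sum>n = 1..Z. g (m * n))"
    unfolding G_def by (simp add: sum.cartesian_product)
  finally show ?thesis by simp
qed

section \<open>Counts and harmonic sums over integers coprime to the modulus\<close>

text \<open>Covers \<open>t < 1\<close> too, as it is applied to \<open>z / d\<close> for divisors
  \<open>d\<close> that may exceed \<open>z\<close>. There the sum is empty and the logarithm is
  controlled by \<open>1 / t\<close>; otherwise the classical bounds for Euler's constant
  apply.\<close>

lemma harm_floor_approx:
  fixes t :: real
  assumes t: "t > 0"
  shows "\<bar>harm (nat \<lfloor>t\<rfloor>) - (ln t + euler_mascheroni)\<bar> \<le> 2 / t"
proof (cases "t < 1")
  case True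
  have "euler_mascheroni < (1::real)"
    using euler_mascheroni_upper[of 0] ln2_ge_two_thirds by (simp add: harm_expand)
  moreover have "euler_mascheroni > (0::real)" by (rule euler_mascheroni_pos)
  moreover have "ln t \<le> 0" using True t by simp
  moreover have "- ln t \<le> 1 / t - 1"
    using ln_le_minus_one[of "1 / t"] t by (simp add: ln_div)
  moreover have "1 < 1 / t" using True t by simp
  moreover have "nat \<lfloor>t\<rfloor> = 0" using True t by simp
  ultimately show ?thesis by (simp add: harm_def)
next
  case False
  define n where "n = nat \<lfloor>t\<rfloor>"
  have n1: "n \<ge> 1" using False unfolding n_def by linarith
  have nt: "real n \<le> t" "t < real n + 1" using False unfolding n_def by linarith+
  have em: "euler_mascheroni \<in> {harm n - ln (real (Suc n)) + inverse (of_nat (2*(n+1)))..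
      harm n - ln (real (Suc n)) + inverse (real (2*n))}"
    by (rule euler_mascheroni_bounds[OF n1])
  have "harm n - ln (real (Suc n)) + inverse (real (2*(n+1))) \<le> euler_mascheroni"
    "euler_mascheroni \<le> harm n - ln (real (Suc n)) + inverse (real (2*n))"
    using em unfolding atLeastAtMost_iff by blast+
  moreover have "inverse (real (2*(n+1))) \<ge> 0" by simp
  \<comment> \<open>Here \<open>t < n + 1 \<le> 2 * n\<close>.\<close>
  moreover have "inverse (real (2*n)) \<le> 1 / t"
    using n1 nt t by (simp add: field_simps)
  moreover have "ln (real (Suc n)) \<ge> ln t" using nt t by simp
  moreover have "ln (real (Suc n)) - ln t \<le> 1 / t"
  proof -
    have "ln (real (Suc n)) - ln t = ln (real (Suc n) / t)" using t by (simp add: ln_div)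
    also have "\<dots> \<le> real (Suc n) / t - 1" using t by (intro ln_le_minus_one) simp
    also have "\<dots> = (real (Suc n) - t) / t" using t by (simp add: field_simps)
    also have "\<dots> \<le> 1 / t" using t nt by (intro divide_right_mono) auto
    finally show ?thesis .
  qed
  moreover have "2 / t = 1 / t + 1 / t" "1 / t > 0" using t by auto
  ultimately show ?thesis unfolding n_def[symmetric] by linarith
qed

lemma abs_moebius_sum_le:
  assumes "\<And>d. d dvd q \<Longrightarrow> \<bar>f d\<bar> \<le> (b::real)"
  shows "\<bar>\<Sum>d | d dvd q. of_int (moebius_mu d) * f d\<bar> \<le> real (tau q) * b"
proof -
  have "\<bar>\<Sum>d | d dvd q. of_int (moebius_mu d) * f d\<bar> \<le> (\<Sum>d | d dvd q. \<bar>of_int (moebius_mu d) * f d\<bar>)"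
    by (rule sum_abs)
  also have "\<dots> \<le> (\<Sum>d | d dvd q. b)"
  proof (intro sum_mono)
    fix d assume "d \<in> {d. d dvd q}"
    then have "\<bar>f d\<bar> \<le> b" using assms by simp
    moreover have "\<bar>real_of_int (moebius_mu d)\<bar> \<le> 1" using abs_moebius_mu_le[of d] by linarith
    then have "\<bar>real_of_int (moebius_mu d)\<bar> * \<bar>f d\<bar> \<le> \<bar>f d\<bar>" by (intro mult_left_le_one_le) auto
    ultimately show "\<bar>of_int (moebius_mu d) * f d\<bar> \<le> b" by (simp add: abs_mult)
  qed
  finally show ?thesis by (simp add: tau_def)
qed

lemma coprime_count_approx:
  assumes q: "q > 0" and z: "z \<ge> 0"
  shows "\<bar>real (card {m. m \<in> {1..nat \<lfloor>z\<rfloor>} \<and> coprime m q}) - real (totient q) / real q * z\<bar> \<le> real (tau q)"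
proof -
  have "real (card {m. m \<in> {1..nat \<lfloor>z\<rfloor>} \<and> coprime m q}) =
      (\<Sum>d | d dvd q. of_int (moebius_mu d) * real (nat \<lfloor>z\<rfloor> div d))"
    using sum_coprime_moebius_nat[OF q, of "\<lambda>_. 1" "nat \<lfloor>z\<rfloor>"] by simp
  then have "real (card {m. m \<in> {1..nat \<lfloor>z\<rfloor>} \<and> coprime m q}) - real (totient q) / real q * z
    = (\<Sum>d | d dvd q. of_int (moebius_mu d) * (real (nat \<lfloor>z\<rfloor> div d) - z / real d))"
    unfolding totient_conv_moebius[OF q]
    by (simp add: sum_subtractf sum_distrib_right right_diff_distrib)
  also have "\<bar>\<dots>\<bar> \<le> real (tau q) * 1"
    by (intro abs_moebius_sum_le abs_nat_floor_div_diff_le z)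
  finally show ?thesis by simp
qed

text \<open>After sieving, \<open>d\<close> contributes \<open>harm (z / d) / d\<close> with the
  argument rounded down. Splitting \<open>ln (z / d)\<close> produces the sum of
  \<open>moebius_mu d * ln d / d\<close> that occurs in \<open>M\<close>, and the error
  \<open>2 * d / z\<close> is divided by \<open>d\<close>, so each divisor costs only
  \<open>2 / z\<close>.\<close>

lemma coprime_harmonic_approx:
  assumes q: "q > 0" and z: "z > 0"
  shows "\<bar>(\<Sum>m | m \<in> {1..nat \<lfloor>z\<rfloor>} \<and> coprime m q. 1 / real m)
      - (real (totient q) / real q * (ln z + euler_mascheroni)
         - (\<Sum>d | d dvd q. of_int (moebius_mu d) * ln (real d) / real d))\<bar> \<le> real (tau q) * (2 / z)"
    (is "\<bar>?s - ?t\<bar> \<le> _")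
proof -
  have "?s = (\<Sum>d | d dvd q. of_int (moebius_mu d) * (harm (nat \<lfloor>z / real d\<rfloor>) / real d))"
    unfolding sum_coprime_moebius_nat[OF q] nat_floor_div[OF less_imp_le[OF z]]
    by (simp add: harm_def sum_divide_distrib inverse_eq_divide mult.commute)
  moreover have "?t = (\<Sum>d | d dvd q. of_int (moebius_mu d) * ((ln (z / real d) + euler_mascheroni) / real d))"
  proof -
    have "(\<Sum>d | d dvd q. of_int (moebius_mu d) * ((ln (z / real d) + euler_mascheroni) / real d))
      = (\<Sum>d | d dvd q. of_int (moebius_mu d) / real d * (ln z + euler_mascheroni)
          - of_int (moebius_mu d) * ln (real d) / real d)"
    proof (intro sum.cong refl)
      fix d assume "d \<in> {d. d dvd q}"
      then have "d > 0" using q by (auto intro: Nat.gr0I)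
      then show "of_int (moebius_mu d) * ((ln (z / real d) + euler_mascheroni) / real d)
          = of_int (moebius_mu d) / real d * (ln z + euler_mascheroni)
          - of_int (moebius_mu d) * ln (real d) / real d"
        using z by (simp add: ln_div field_simps)
    qed
    then show ?thesis unfolding totient_conv_moebius[OF q] by (simp only: sum_subtractf sum_distrib_right)
  qed
  ultimately have "?s - ?t = (\<Sum>d | d dvd q. of_int (moebius_mu d) *
      ((harm (nat \<lfloor>z / real d\<rfloor>) - (ln (z / real d) + euler_mascheroni)) / real d))"
    by (simp only: sum_subtractf right_diff_distrib diff_divide_distrib)
  also have "\<bar>\<dots>\<bar> \<le> real (tau q) * (2 / z)"
  proof (rule abs_moebius_sum_le)
    fix d assume "d dvd q"
    then have d: "d > 0" using q by (auto intro: Nat.gr0I)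
    then have "\<bar>harm (nat \<lfloor>z / real d\<rfloor>) - (ln (z / real d) + euler_mascheroni)\<bar> / real d
        \<le> (2 / (z / real d)) / real d"
      using z by (intro divide_right_mono harm_floor_approx) auto
    then show "\<bar>(harm (nat \<lfloor>z / real d\<rfloor>) - (ln (z / real d) + euler_mascheroni)) / real d\<bar> \<le> 2 / z"
      using d by simp
  qed
  finally show ?thesis .
qed

section \<open>Comparison with the main term\<close>

lemma sum_S_eq_sum_tau:
  "(\<Sum>a\<in>F. S X a q) = (\<Sum>n = 1..nat \<lfloor>X\<rfloor>. real (tau n) * (\<Sum>a\<in>F. of_bool ([int n = a] (mod int q))))"
proof -
  have "S X a q = (\<Sum>n = 1..nat \<lfloor>X\<rfloor>. real (tau n) * of_bool ([int n = a] (mod int q)))" for a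
  proof -
    have "1 \<le> n \<and> real n \<le> X \<longleftrightarrow> n \<in> {1..nat \<lfloor>X\<rfloor>}" for n
      unfolding atLeastAtMost_iff by linarith
    then have "S X a q = (\<Sum>n | n \<in> {1..nat \<lfloor>X\<rfloor>} \<and> [int n = a] (mod int q). real (tau n))"
      unfolding S_def by (intro sum.cong) blast+
    also have "\<dots> = (\<Sum>n = 1..nat \<lfloor>X\<rfloor>. if [int n = a] (mod int q) then real (tau n) else 0)"
      by (rule sum.inter_filter) simp
    also have "\<dots> = (\<Sum>n = 1..nat \<lfloor>X\<rfloor>. real (tau n) * of_bool ([int n = a] (mod int q)))"
      by (intro sum.cong) auto
    finally show ?thesis .
  qed
  then have "(\<Sum>a\<in>F. S X a q) = (\<Sum>n = 1..nat \<lfloor>X\<rfloor>. \<Sum>a\<in>F. real (tau n) * of_bool ([int n = a] (mod int q)))"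
    by (simp only: sum.swap[of _ F])
  then show ?thesis by (simp only: sum_distrib_left)
qed

text \<open>Both sums of the hyperbola formula are replaced by their expected values at cost
  \<open>Err\<close> each. Those expected values reproduce the sum of \<open>M\<close> up to a
  multiple of \<open>tau q * sqrt X\<close>.\<close>

lemma sum_R_reduced_part_le:
  fixes A Z :: nat and X T :: real
  assumes q: "q > 0" and A: "A \<le> q" and X: "X \<ge> 1" and Z: "Z = nat \<lfloor>sqrt X\<rfloor>" and T0: "T \<ge> 0"
    and T: "\<And>w. 0 < w \<Longrightarrow> w \<le> q * Z \<Longrightarrow> real (tau w) \<le> T"
  shows "\<bar>\<Sum>a\<in>reduced_part (interval B A) q. R X a q\<bar>
    \<le> real (tau q) * (3 * (T * ((real A + 4 * real Z * harm Z) * (2 * harm q)) + real Z) + 5 * sqrt X)"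
proof -
  define F where "F = reduced_part (interval B A) q"
  define P where "P = real (card F) / real q"
  define g where "g n = (\<Sum>a\<in>F. of_bool ([int n = a] (mod int q)) :: real)" for n
  define Q where "Q = {m. m \<in> {1..Z} \<and> coprime m q}"
  define Err where "Err = real (tau q) * (T * ((real A + 4 * real Z * harm Z) * (2 * harm q)) + real Z)"
  define s where "s = sqrt X"
  define \<Phi> where "\<Phi> = real (totient q) / real q"
  define \<Lambda> where "\<Lambda> = (\<Sum>d | d dvd q. of_int (moebius_mu d) * ln (real d) / real d)"
  define V where "V = (\<Sum>m\<in>Q. 1 / real m)"
  define W where "W = real (card Q)"
  have s: "s \<ge> 1" "s * s = X" "s > 0" using X by (auto simp: s_def)
  have Zs: "Z = nat \<lfloor>s\<rfloor>" by (simp add: Z s_def)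
  \<comment> \<open>An integer congruent modulo \<open>q\<close> to an element of \<open>F\<close>
    is coprime to \<open>q\<close>, so only \<open>m\<close> in \<open>Q\<close> contribute.\<close>
  have g0: "g (m * n) = 0" if "\<not> coprime m q" for m n
  proof -
    have "\<not> [int (m * n) = a] (mod int q)" if "a \<in> F" for a
    proof
      assume "[int (m * n) = a] (mod int q)"
      then have "coprime (int (m * n)) (int q)"
        using that by (auto simp: F_def reduced_part_def coprime_commute dest: cong_imp_coprime[OF cong_sym])
      then show False using \<open>\<not> coprime m q\<close> by simp
    qed
    then show ?thesis by (simp add: g_def)
  qed
  have hyperbola: "(\<Sum>a\<in>F. S X a q)
      = 2 * (\<Sum>m\<in>Q. \<Sum>n = 1..nat \<lfloor>X / real m\<rfloor>. g (m * n)) - (\<Sum>m\<in>Q. \<Sum>n = 1..nat \<lfloor>s\<rfloor>. g (m * n))"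
  proof -
    have "real Z \<le> s" "s < real Z + 1" using s unfolding Zs by linarith+
    then have "real Z * real Z \<le> X" "X < (real Z + 1) * (real Z + 1)"
      using s by (auto simp flip: s(2) intro: mult_mono mult_strict_mono)
    then have "real (Z ^ 2) \<le> X" "X < real ((Z + 1) ^ 2)" by (simp_all add: power2_eq_square algebra_simps)
    then have "Z ^ 2 \<le> nat \<lfloor>X\<rfloor>" "nat \<lfloor>X\<rfloor> < (Z + 1) ^ 2" by linarith+
    then have "(\<Sum>a\<in>F. S X a q) = 2 * (\<Sum>m = 1..Z. \<Sum>n = 1..nat \<lfloor>X\<rfloor> div m. g (m * n))
        - (\<Sum>m = 1..Z. \<Sum>n = 1..Z. g (m * n))"
      unfolding sum_S_eq_sum_tau g_def[symmetric] by (rule sum_tau_hyperbola)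
    moreover have "(\<Sum>m = 1..Z. \<Sum>n = 1..f m. g (m * n)) = (\<Sum>m\<in>Q. \<Sum>n = 1..f m. g (m * n))" for f
      by (rule sum.mono_neutral_right) (auto simp: Q_def g0)
    ultimately show ?thesis using X by (simp add: nat_floor_div Zs)
  qed
  have finQ: "finite Q" by (simp add: Q_def)
  \<comment> \<open>Used twice: with \<open>X / m\<close> for the region under the hyperbola and
    with the constant \<open>s\<close> for the square.\<close>
  have count: "\<bar>(\<Sum>m\<in>Q. \<Sum>n = 1..nat \<lfloor>y m\<rfloor>. g (m * n)) - P * (\<Sum>m\<in>Q. y m)\<bar> \<le> Err"
    if y: "\<And>m. y m \<ge> 0" for y
  proof -
    have "(\<Sum>m\<in>Q. \<Sum>n = 1..nat \<lfloor>y m\<rfloor>. g (m * n)) - P * (\<Sum>m\<in>Q. y m)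
        = (\<Sum>m\<in>Q. (\<Sum>n = 1..nat \<lfloor>y m\<rfloor>. g (m * n)) - P * y m)"
      by (simp only: sum_subtractf sum_distrib_left)
    also have "\<bar>\<dots>\<bar> \<le> (\<Sum>m\<in>Q. \<bar>(\<Sum>n = 1..nat \<lfloor>y m\<rfloor>. g (m * n)) - P * y m\<bar>)" by (rule sum_abs)
    also have "\<dots> \<le> Err"
      unfolding Q_def g_def P_def F_def Err_def
      by (rule sum_reduced_count_error_le[OF q A T0 T y])
    finally show ?thesis .
  qed
  have c1: "\<bar>(\<Sum>m\<in>Q. \<Sum>n = 1..nat \<lfloor>X / real m\<rfloor>. g (m * n)) - P * (X * V)\<bar> \<le> Err"
    using count[of "\<lambda>m. X / real m"] X by (simp add: V_def sum_distrib_left)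
  have c2: "\<bar>(\<Sum>m\<in>Q. \<Sum>n = 1..nat \<lfloor>s\<rfloor>. g (m * n)) - P * (s * W)\<bar> \<le> Err"
    using count[of "\<lambda>_. s"] s by (simp add: W_def mult.commute)
  have v: "\<bar>V - (\<Phi> * (ln s + euler_mascheroni) - \<Lambda>)\<bar> \<le> real (tau q) * (2 / s)"
    using coprime_harmonic_approx[OF q s(3)] unfolding V_def Q_def Zs \<Phi>_def \<Lambda>_def .
  have w: "\<bar>W - \<Phi> * s\<bar> \<le> real (tau q)"
    using coprime_count_approx[OF q less_imp_le[OF s(3)]] unfolding W_def Q_def Zs \<Phi>_def .
  have "card F \<le> card (interval B A)"
    unfolding F_def by (intro card_mono) (auto simp: reduced_part_def interval_def)
  also have "\<dots> = A" by (simp add: interval_def)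
  finally have P: "0 \<le> P" "P \<le> 1" using A q by (simp_all add: P_def)
  \<comment> \<open>Writing \<open>X = s * s\<close> turns \<open>ln X\<close> into
    \<open>2 * ln s\<close> and splits the main term into the parts predicted for the two hyperbola
    sums; the square accounts for the \<open>- 1\<close>.\<close>
  have M: "(\<Sum>a\<in>F. M X a q)
      = P * (2 * X * (\<Phi> * (ln s + euler_mascheroni) - \<Lambda>) - s * (\<Phi> * s))"
  proof -
    have "ln X = 2 * ln s" using s by (simp flip: s(2) add: ln_mult)
    then have "(\<Sum>a\<in>F. M X a q) = real (card F) *
        (\<Phi> / real q * X * (2 * ln s + 2 * euler_mascheroni - 1) - 2 / real q * X * \<Lambda>)"
      by (simp add: M_def \<Phi>_def \<Lambda>_def power2_eq_square)
    also have "\<dots> = P * (2 * X * (\<Phi> * (ln s + euler_mascheroni) - \<Lambda>) - X * \<Phi>)"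
      using q by (simp add: P_def field_simps)
    also have "X * \<Phi> = s * (\<Phi> * s)" using s(2) by (simp add: mult_ac)
    finally show ?thesis .
  qed
  have "\<bar>2 * X * V - s * W - (2 * X * (\<Phi> * (ln s + euler_mascheroni) - \<Lambda>) - s * (\<Phi> * s))\<bar>
      = \<bar>2 * X * (V - (\<Phi> * (ln s + euler_mascheroni) - \<Lambda>)) - s * (W - \<Phi> * s)\<bar>"
    by (simp add: algebra_simps)
  also have "\<dots> \<le> \<bar>2 * X * (V - (\<Phi> * (ln s + euler_mascheroni) - \<Lambda>))\<bar> + \<bar>s * (W - \<Phi> * s)\<bar>"
    by (rule abs_triangle_ineq4)
  also have "\<dots> = 2 * X * \<bar>V - (\<Phi> * (ln s + euler_mascheroni) - \<Lambda>)\<bar> + s * \<bar>W - \<Phi> * s\<bar>"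
    using X s by (simp add: abs_mult)
  also have "\<dots> \<le> 2 * X * (real (tau q) * (2 / s)) + s * real (tau q)"
    using X s v w by (intro add_mono mult_left_mono) auto
  also have "\<dots> = 5 * real (tau q) * s"
    using s(3) by (simp flip: s(2) add: field_simps)
  finally have main: "\<bar>2 * X * V - s * W - (2 * X * (\<Phi> * (ln s + euler_mascheroni) - \<Lambda>) - s * (\<Phi> * s))\<bar>
      \<le> 5 * real (tau q) * s" (is "\<bar>?D\<bar> \<le> _") .
  have "\<bar>P * ?D\<bar> \<le> \<bar>?D\<bar>"
    using P unfolding abs_mult by (intro mult_left_le_one_le) auto
  with main have main': "\<bar>P * ?D\<bar> \<le> 5 * real (tau q) * s" by linarith
  have "(\<Sum>a\<in>F. R X a q) = (\<Sum>a\<in>F. S X a q) - (\<Sum>a\<in>F. M X a q)"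
    by (simp add: R_def sum_subtractf)
  also have "\<dots> = 2 * ((\<Sum>m\<in>Q. \<Sum>n = 1..nat \<lfloor>X / real m\<rfloor>. g (m * n)) - P * (X * V))
      - ((\<Sum>m\<in>Q. \<Sum>n = 1..nat \<lfloor>s\<rfloor>. g (m * n)) - P * (s * W)) + P * ?D"
    unfolding hyperbola M by (simp add: algebra_simps)
  finally have R: "(\<Sum>a\<in>F. R X a q)
      = 2 * ((\<Sum>m\<in>Q. \<Sum>n = 1..nat \<lfloor>X / real m\<rfloor>. g (m * n)) - P * (X * V))
      - ((\<Sum>m\<in>Q. \<Sum>n = 1..nat \<lfloor>s\<rfloor>. g (m * n)) - P * (s * W)) + P * ?D" .
  \<comment> \<open>The hyperbola sum enters twice and the square once, hence
    \<open>3 * e\<close>.\<close>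
  have "\<bar>2 * x - y + z\<bar> \<le> 3 * e + f" if "\<bar>x\<bar> \<le> e" "\<bar>y\<bar> \<le> e" "\<bar>z\<bar> \<le> f" for x y z e f :: real
    using that by linarith
  from this[OF c1 c2 main'] have "\<bar>\<Sum>a\<in>F. R X a q\<bar> \<le> 3 * Err + 5 * real (tau q) * s"
    unfolding R .
  also have "\<dots> = real (tau q) * (3 * (T * ((real A + 4 * real Z * harm Z) * (2 * harm q)) + real Z) + 5 * sqrt X)"
    by (simp add: Err_def s_def algebra_simps)
  finally show ?thesis unfolding F_def .
qed

section \<open>Final size estimates\<close>

lemma one_plus_ln_le_powr:
  fixes x \<epsilon> :: real
  assumes "x \<ge> 1" "\<epsilon> > 0"
  shows "1 + ln x \<le> (1 + 1 / \<epsilon>) * x powr \<epsilon>"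
proof -
  have "ln x \<le> x powr \<epsilon> / \<epsilon>" using assms by (rule ln_powr_bound)
  moreover have "1 \<le> x powr \<epsilon>" using assms by (simp add: ge_one_powr_ge_zero)
  ultimately show ?thesis by (simp add: distrib_right)
qed

text \<open>Each of the three quantities in the minimum contains \<open>sqrt X\<close> with a factor
  at least 1; in the second one this is \<open>A powr (1/4)\<close>, by
  \<open>A \<ge> 1\<close>.\<close>

lemma sqrt_le_E:
  assumes "A \<ge> 1" "X \<ge> 0"
  shows "sqrt X \<le> E A X q"
proof -
  have sq: "X powr (1/2) = sqrt X" using assms by (simp add: powr_half_sqrt)
  have "1 \<le> real A powr (1/4)" using assms by (simp add: ge_one_powr_ge_zero)
  then have "sqrt X * 1 \<le> sqrt X * (real A powr (1/4) + real A * real q powr (- 1/2))"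
    using assms by (intro mult_left_mono) (auto intro: add_increasing2)
  moreover have "sqrt X * 1 \<le> sqrt X * (1 + real A * real q powr (- 1/4))"
    using assms by (intro mult_left_mono) auto
  ultimately show ?thesis unfolding E_def sq by simp
qed

theorem theorem3p2:
  fixes \<epsilon> :: real
  assumes "\<epsilon> > 0"
  shows "\<exists>C>0::real. \<exists>X0::real. \<forall>(q::nat) (A::nat) (B::int) (X::real).
           q > 0 \<longrightarrow> A < q \<longrightarrow> X \<ge> max (real q) X0 \<longrightarrow>
           real q ^ 3 < real A * X\<^sup>2 / 8 \<longrightarrow>
           \<bar>\<Sum>a\<in>reduced_part (interval B A) q. R X a q\<bar>
             \<le> C * X powr \<epsilon> * (E A X q + real A powr (2/3) * X powr (1/3))"
proof -
  \<comment> \<open>Five factors \<open>X powr \<delta>\<close> will occur: one from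
    \<open>tau q\<close>, two from \<open>tau w\<close> with \<open>w \<le> X * X\<close>, and one
    from each of the two harmonic numbers.\<close>
  define \<delta> where "\<delta> = \<epsilon> / 5"
  have \<delta>: "\<delta> > 0" using assms by (simp add: \<delta>_def)
  obtain C1 where C1: "C1 \<ge> 1" "\<And>n. n > 0 \<Longrightarrow> real (tau n) \<le> C1 * real n powr \<delta>"
    using tau_le_powr[OF \<delta>] by blast
  define D where "D = 1 + 1 / \<delta>"
  have D: "D \<ge> 1" using \<delta> by (simp add: D_def)
  have bound: "\<bar>\<Sum>a\<in>reduced_part (interval B A) q. R X a q\<bar>
      \<le> 32 * C1\<^sup>2 * D\<^sup>2 * X powr \<epsilon> * (E A X q + real A powr (2/3) * X powr (1/3))"
    if q: "q > 0" and Aq: "A < q" and X: "X \<ge> max (real q) 1" and H: "real q ^ 3 < real A * X\<^sup>2 / 8"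
    for q A :: nat and B :: int and X :: real
  proof -
    define U where "U = X powr \<delta>"
    define Z where "Z = nat \<lfloor>sqrt X\<rfloor>"
    define Y where "Y = real A powr (2/3) * X powr (1/3) + sqrt X"
    have X1: "X \<ge> 1" "real q \<le> X" using X by auto
    have U1: "U \<ge> 1" using X1 \<delta> by (simp add: U_def ge_one_powr_ge_zero)
    \<comment> \<open>For \<open>A = 0\<close> the right side of \<open>H\<close> would
      vanish.\<close>
    have A1: "A \<ge> 1" using H by (cases "A = 0") auto
    have Z1: "Z \<ge> 1" using X1 by (simp add: Z_def le_nat_iff)
    have Zs: "real Z \<le> sqrt X" using X1 by (simp add: Z_def)
    have "sqrt X \<le> X" using X1 by (simp add: real_le_lsqrt power2_eq_square)
    then have ZX: "real Z \<le> X" using Zs by linarith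
    have "real A = real A powr (2/3) * real A powr (1/3)" using A1 by (simp flip: powr_add)
    also have "\<dots> \<le> real A powr (2/3) * X powr (1/3)"
      using Aq X1 by (intro mult_left_mono powr_mono2) auto
    finally have AY: "real A \<le> real A powr (2/3) * X powr (1/3)" .
    have harm_le: "harm n \<le> D * U" if "n \<ge> 1" "real n \<le> X" for n
    proof -
      have "harm n \<le> 1 + ln (real n)" using that by (intro harm_le_1_plus_ln) auto
      also have "\<dots> \<le> 1 + ln X" using that X1 by simp
      also have "\<dots> \<le> D * U" unfolding D_def U_def by (rule one_plus_ln_le_powr[OF X1(1) \<delta>])
      finally show ?thesis .
    qed
    have tauq: "real (tau q) \<le> C1 * U"
    proof -
      have "real q powr \<delta> \<le> U" unfolding U_def using X1 \<delta> by (intro powr_mono2) auto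
      then show ?thesis using C1(2)[OF q] C1(1) by (meson mult_left_mono order_trans zero_le_one)
    qed
    have tauw: "real (tau w) \<le> C1 * U\<^sup>2" if "0 < w" "w \<le> q * Z" for w
    proof -
      have "real w \<le> real (q * Z)" using that by (simp only: of_nat_le_iff)
      also have "\<dots> \<le> X * X" using X1 ZX by (simp add: mult_mono)
      finally have "real w powr \<delta> \<le> (X * X) powr \<delta>" using \<delta> by (intro powr_mono2) auto
      also have "\<dots> = U\<^sup>2" using X1 by (simp add: powr_mult U_def power2_eq_square)
      finally show ?thesis using C1(2)[OF that(1)] C1(1) by (meson mult_left_mono order_trans zero_le_one)
    qed
    have Y0: "sqrt X \<le> Y" "Y \<ge> 0" using AY X1 by (auto simp: Y_def)
    have DU: "D * U \<ge> 1" using D U1 mult_mono[of 1 D 1 U] by simp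
    have "real A + 4 * real Z * harm Z \<le> real A + 4 * sqrt X * (D * U)"
      using Zs harm_le[OF Z1 ZX] X1 harm_nonneg[of Z] by (intro add_left_mono mult_mono) auto
    also have "\<dots> \<le> 4 * (D * U) * (real A powr (2/3) * X powr (1/3)) + 4 * (D * U) * sqrt X"
    proof -
      have "1 * real A \<le> 4 * (D * U) * (real A powr (2/3) * X powr (1/3))"
        using DU AY by (intro mult_mono) auto
      then show ?thesis by (simp add: mult_ac)
    qed
    finally have a: "real A + 4 * real Z * harm Z \<le> 4 * (D * U) * Y" by (simp add: Y_def distrib_left)
    have "C1 * U\<^sup>2 * ((real A + 4 * real Z * harm Z) * (2 * harm q))
      \<le> C1 * U\<^sup>2 * ((4 * (D * U) * Y) * (2 * (D * U)))"
      using a harm_le[of q] q X1 C1 DU Y0 harm_nonneg[of q]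
      by (intro mult_left_mono mult_mono) auto
    also have "\<dots> = 8 * (C1 * D\<^sup>2 * U ^ 4 * Y)" by (simp add: power2_eq_square power4_eq_xxxx)
    finally have K: "C1 * U\<^sup>2 * ((real A + 4 * real Z * harm Z) * (2 * harm q)) \<le> 8 * (C1 * D\<^sup>2 * U ^ 4 * Y)" .
    have "1 \<le> C1 * D\<^sup>2 * U ^ 4"
      using C1(1) D U1 mult_mono[of 1 "C1 * D\<^sup>2" 1 "U ^ 4"] mult_mono[of 1 C1 1 "D\<^sup>2"] by (simp add: one_le_power)
    then have "1 * Y \<le> C1 * D\<^sup>2 * U ^ 4 * Y" using Y0 by (intro mult_right_mono) auto
    then have "Y \<le> C1 * D\<^sup>2 * U ^ 4 * Y" by simp
    \<comment> \<open>The constant is \<open>3 * (8 + 1) + 5 = 32\<close>.\<close>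
    moreover have "3 * (k + z) + 5 * r \<le> 32 * v" if "k \<le> 8 * v" "z \<le> r" "r \<le> y" "y \<le> v"
      for k z r y v :: real using that by (smt (verit))
    ultimately have K': "3 * (C1 * U\<^sup>2 * ((real A + 4 * real Z * harm Z) * (2 * harm q)) + real Z) + 5 * sqrt X
        \<le> 32 * (C1 * D\<^sup>2 * U ^ 4 * Y)"
      using K Zs Y0(1) by blast
    have "\<bar>\<Sum>a\<in>reduced_part (interval B A) q. R X a q\<bar> \<le> real (tau q) *
       (3 * (C1 * U\<^sup>2 * ((real A + 4 * real Z * harm Z) * (2 * harm q)) + real Z) + 5 * sqrt X)"
      using Aq C1(1) by (intro sum_R_reduced_part_le[OF q _ X1(1) Z_def _ tauw]) auto
    also have "\<dots> \<le> (C1 * U) * (32 * (C1 * D\<^sup>2 * U ^ 4 * Y))"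
    proof (rule mult_mono[OF tauq K'])
      show "0 \<le> C1 * U" using C1(1) U1 by simp
      show "0 \<le> 3 * (C1 * U\<^sup>2 * ((real A + 4 * real Z * harm Z) * (2 * harm q)) + real Z) + 5 * sqrt X"
        using C1(1) X1 harm_nonneg[of Z] harm_nonneg[of q]
        by (intro add_nonneg_nonneg mult_nonneg_nonneg) auto
    qed
    also have "\<dots> = 32 * C1\<^sup>2 * D\<^sup>2 * U ^ 5 * Y" by (simp add: power2_eq_square eval_nat_numeral)
    also have "U ^ 5 = X powr \<epsilon>"
      unfolding U_def \<delta>_def using X1 by (simp add: powr_power)
    also have "32 * C1\<^sup>2 * D\<^sup>2 * X powr \<epsilon> * Y
        \<le> 32 * C1\<^sup>2 * D\<^sup>2 * X powr \<epsilon> * (E A X q + real A powr (2/3) * X powr (1/3))"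
      using sqrt_le_E[OF A1, of X q] X1 by (intro mult_left_mono) (auto simp: Y_def)
    finally show ?thesis .
  qed
  have "32 * C1\<^sup>2 * D\<^sup>2 > 0" using C1 D by simp
  with bound show ?thesis by blast
qed

end
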